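(* Let $r,t \ge 1$ be integers. If $M$ is a simple rank-$r$ matroid with no $(t+1)$-claw, then $|E(M)| \ge |E(M_{r,t})|$. If equality holds and $r \ge 2t$, then $M \cong M_{r,t}$.
   Context: A claw of a matroid $M$ is a set $S \subseteq E(M)$ that is both a flat and an independent set of $M$; a $k$-claw is a claw of size $k$. For integers $r,t \ge 1$, $M_{r,t}$ denotes the matroid that is the direct sum of $t$ (possibly empty, i.e. rank-$0$) binary projective geometries whose ranks sum to $r$ and pairwise differ by at most $1$ (a rank-$n$ binary projective geometry $\mathrm{PG}(n-1,2)$ has $2^n-1$ elements). *)

theory Defs
  imports Main
begin

definition matroid :: "'a set \<Rightarrow> ('a set \<Rightarrow> bool) \<Rightarrow> bool" where
  "matroid E indep \<longleftrightarrow>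
     finite E \<and>
     (\<forall>X. indep X \<longrightarrow> X \<subseteq> E) \<and>
     indep {} \<and>
     (\<forall>X Y. indep X \<and> Y \<subseteq> X \<longrightarrow> indep Y) \<and>
     (\<forall>X Y. indep X \<and> indep Y \<and> card X < card Y \<longrightarrow>
        (\<exists>y \<in> Y - X. indep (insert y X)))"

definition mrank :: "'a set \<Rightarrow> ('a set \<Rightarrow> bool) \<Rightarrow> 'a set \<Rightarrow> nat" where
  "mrank E indep X = Max {card Y | Y. Y \<subseteq> X \<and> indep Y}"

definition mclosure :: "'a set \<Rightarrow> ('a set \<Rightarrow> bool) \<Rightarrow> 'a set \<Rightarrow> 'a set" where
  "mclosure E indep X = {x \<in> E. mrank E indep (insert x X) = mrank E indep X}"

definition flat :: "'a set \<Rightarrow> ('a set \<Rightarrow> bool) \<Rightarrow> 'a set \<Rightarrow> bool" where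
  "flat E indep X \<longleftrightarrow> X \<subseteq> E \<and> mclosure E indep X = X"

definition claw :: "'a set \<Rightarrow> ('a set \<Rightarrow> bool) \<Rightarrow> 'a set \<Rightarrow> bool" where
  "claw E indep S \<longleftrightarrow> flat E indep S \<and> indep S"

definition simple_matroid :: "'a set \<Rightarrow> ('a set \<Rightarrow> bool) \<Rightarrow> bool" where
  "simple_matroid E indep \<longleftrightarrow> (\<forall>x\<in>E. \<forall>y\<in>E. indep {x, y})"

definition matroid_iso ::
  "'a set \<Rightarrow> ('a set \<Rightarrow> bool) \<Rightarrow> 'b set \<Rightarrow> ('b set \<Rightarrow> bool) \<Rightarrow> bool" where
  "matroid_iso E indep E' indep' \<longleftrightarrow>
     (\<exists>f. bij_betw f E E' \<and> (\<forall>X. X \<subseteq> E \<longrightarrow> (indep X \<longleftrightarrow> indep' (f ` X))))"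

text \<open>Vectors of GF(2)^n are represented as subsets of {..<n} (their supports);
  vector addition is symmetric difference. The sum of a finite family T of vectors
  has coordinate j equal to the parity of the number of members containing j.\<close>
definition gf2_sum :: "nat set set \<Rightarrow> nat set" where
  "gf2_sum T = {j. odd (card {v \<in> T. j \<in> v})}"

definition gf2_indep :: "nat set set \<Rightarrow> bool" where
  "gf2_indep S \<longleftrightarrow> (\<forall>T \<subseteq> S. T \<noteq> {} \<longrightarrow> gf2_sum T \<noteq> {})"

text \<open>Ground set of PG(n-1,2): the nonzero vectors of GF(2)^n.\<close>
definition PG_ground :: "nat \<Rightarrow> nat set set" where
  "PG_ground n = {v. v \<subseteq> {..<n} \<and> v \<noteq> {}}"

text \<open>Ranks of the t components of M_{r,t}: they sum to r and differ pairwise by at most 1.\<close>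
definition comp_rank :: "nat \<Rightarrow> nat \<Rightarrow> nat \<Rightarrow> nat" where
  "comp_rank r t i = r div t + (if i < r mod t then 1 else 0)"

text \<open>M_{r,t}: direct sum of the binary projective geometries PG(comp_rank r t i - 1, 2), i < t.
  Element (i,v) is the vector v of the i-th component.\<close>
definition Mrt_ground :: "nat \<Rightarrow> nat \<Rightarrow> (nat \<times> nat set) set" where
  "Mrt_ground r t = {(i, v). i < t \<and> v \<in> PG_ground (comp_rank r t i)}"

definition Mrt_indep :: "nat \<Rightarrow> nat \<Rightarrow> (nat \<times> nat set) set \<Rightarrow> bool" where
  "Mrt_indep r t X \<longleftrightarrow> X \<subseteq> Mrt_ground r t \<and> (\<forall>i<t. gf2_indep {v. (i, v) \<in> X})"

end

theory Submission
  imports Defs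
begin

text \<open>
  Let \<open>S\<close> be an inclusion-maximal claw of \<open>M\<close>, of size \<open>s \<le> t\<close>. By maximality every parallel class of
  \<open>M / S\<close> has at least two elements, and \<open>M / S\<close> again has no \<open>(t + 1)\<close>-claw, so
  \<open>|M| \<ge> s + 2 |si (M / S)|\<close>; since \<open>|M\<^bsub>r,t\<^esub>| = t + 2 |M\<^bsub>r-t,t\<^esub>|\<close>, the bound follows by induction on the rank.

  In the case of equality with \<open>r \<ge> 2 t\<close>, every claw extends to a \<open>t\<close>-claw and all the parallel classes
  above are pairs. Applying this to a \<open>t\<close>-claw \<open>S\<close> and to a \<open>t\<close>-claw \<open>Z\<close> of \<open>M / S\<close>, each \<open>z \<in> Z\<close> lies with its
  partner \<open>z'\<close> in a circuit \<open>{z, z'} \<union> T\<^sub>z\<close>, \<open>T\<^sub>z \<subseteq> S\<close>. If \<open>s \<in> T\<^sub>z \<inter> T\<^sub>w\<close> for distinct \<open>z\<close>, \<open>w\<close>, then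
  \<open>(S - {s}) \<union> {z, w}\<close> is a \<open>(t + 1)\<close>-claw; so the \<open>t\<close> nonempty sets \<open>T\<^sub>z\<close> partition \<open>S\<close> into singletons.
  Hence each element outside \<open>S\<close> is on exactly one long line with a member of \<open>S\<close>, and that line has three
  points. This makes ``equal or on a long line'' an equivalence relation with \<open>t\<close> classes. A class of rank
  \<open>n\<close> has at least \<open>2 ^ n - 1\<close> elements, and by convexity equality forces balanced ranks summing to \<open>r\<close>, so
  that \<open>M\<close> is the direct sum of its classes and each class is a binary projective geometry.
\<close>

section \<open>The size of the extremal matroid\<close>

text \<open>This is the size of the extremal matroid counted one rank at a time: when ranks are
  dealt to the \<open>t\<close> components in turn, the unit with index \<open>k\<close> raises a
  component from rank \<open>k div t\<close> to the next and adds \<open>2 ^ (k div t)\<close>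
  elements.\<close>

definition extremal_size :: "nat \<Rightarrow> nat \<Rightarrow> nat" where
  "extremal_size m t = (\<Sum>k<m. 2 ^ (k div t))"

lemma extremal_size_add_self:
  assumes "0 < t" shows "extremal_size (m + t) t = t + 2 * extremal_size m t"
proof (induction m)
  case 0
  show ?case by (simp add: extremal_size_def)
next
  case (Suc m)
  have "extremal_size (Suc m + t) t = extremal_size (m + t) t + 2 ^ ((m + t) div t)"
    "extremal_size (Suc m) t = extremal_size m t + 2 ^ (m div t)"
    unfolding extremal_size_def by simp_all
  moreover have "(m + t) div t = Suc (m div t)" using assms by (simp add: div_add_self2)
  ultimately show ?case using Suc by simp
qed

lemma extremal_size_small: "m \<le> t \<Longrightarrow> extremal_size m t = m"
  unfolding extremal_size_def by simp

lemma extremal_size_add_ge: "extremal_size m t + k \<le> extremal_size (m + k) t"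
proof (induction k)
  case (Suc k)
  have "(1::nat) \<le> 2 ^ ((m + k) div t)" by simp
  moreover have "extremal_size (m + Suc k) t = extremal_size (m + k) t + 2 ^ ((m + k) div t)"
    unfolding extremal_size_def by simp
  ultimately show ?case using Suc by linarith
qed simp

text \<open>The inductive inequality for a maximal claw of size \<open>s\<close>: the claw itself
  gives \<open>s\<close> points, and each point of the contraction gives at least two. For
  \<open>t \<le> m\<close> the surplus \<open>t - s\<close> is recorded, so that equality later
  forces \<open>s = t\<close>; for \<open>m < t\<close> the sizes are just the ranks.\<close>

lemma extremal_size_step:
  assumes "0 < t" "s \<le> t" "s \<le> m"
  shows "extremal_size m t + (if t \<le> m then t - s else 0) \<le> s + 2 * extremal_size (m - s) t"
proof (cases "t \<le> m")
  case True
  have "extremal_size (m - t) t + (t - s) \<le> extremal_size (m - s) t"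
    using extremal_size_add_ge[of "m - t" t "t - s"] True assms by simp
  moreover have "extremal_size m t = t + 2 * extremal_size (m - t) t"
    using extremal_size_add_self[OF assms(1), of "m - t"] True by simp
  ultimately show ?thesis using True assms by simp
next
  case False
  then show ?thesis using assms by (simp add: extremal_size_small)
qed

section \<open>Counting the elements of \<open>Mrt_ground\<close>\<close>

lemma finite_PG_ground: "finite (PG_ground n)"
  unfolding PG_ground_def by (rule finite_subset[of _ "Pow {..<n}"]) auto

lemma card_PG_ground: "card (PG_ground n) = 2 ^ n - 1"
proof -
  have "PG_ground n = Pow {..<n} - {{}}" unfolding PG_ground_def by auto
  then show ?thesis by (simp add: card_Pow)
qed

lemma card_Mrt_ground_sum: "card (Mrt_ground r t) = (\<Sum>i<t. 2 ^ comp_rank r t i - 1)"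
proof -
  have "Mrt_ground r t = Sigma {..<t} (\<lambda>i. PG_ground (comp_rank r t i))"
    unfolding Mrt_ground_def by auto
  then show ?thesis by (simp add: card_PG_ground finite_PG_ground)
qed

lemma card_Mrt_ground:
  assumes "0 < t"
  shows "card (Mrt_ground r t) = t * (2 ^ (r div t) - 1) + (r mod t) * 2 ^ (r div t)"
proof -
  let ?q = "r div t"
  have "2 ^ comp_rank r t i - 1 = (2 ^ ?q - 1) + (if i < r mod t then 2 ^ ?q else (0::nat))" for i
    unfolding comp_rank_def using one_le_power[of "2::nat" ?q] by (simp add: mult_2)
  then have "card (Mrt_ground r t)
      = (\<Sum>i<t. (2 ^ ?q - 1) + (if i < r mod t then 2 ^ ?q else (0::nat)))"
    unfolding card_Mrt_ground_sum by simp
  also have "\<dots> = t * (2 ^ ?q - 1) + (\<Sum>i<t. if i < r mod t then 2 ^ ?q else (0::nat))"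
    by (subst sum.distrib) simp
  also have "(\<Sum>i<t. if i < r mod t then 2 ^ ?q else (0::nat)) = (\<Sum>i<r mod t. 2 ^ ?q)"
  proof (rule sum.mono_neutral_cong_right)
    show "{..<r mod t} \<subseteq> {..<t}"
      using mod_less_divisor[OF assms, of r] by auto
  qed auto
  finally show ?thesis by simp
qed

text \<open>For \<open>r < t\<close> both sides are \<open>r\<close>, and both satisfy the recursion
  f(m + t) = t + 2 f(m), so strong induction in steps of \<open>t\<close> applies.\<close>

lemma card_Mrt_ground_eq_extremal_size:
  assumes "0 < t" shows "card (Mrt_ground r t) = extremal_size r t"
proof (induction r rule: less_induct)
  case (less r)
  show ?case
  proof (cases "r < t")
    case True
    then show ?thesis using assms by (simp add: card_Mrt_ground extremal_size_small)
  next
    case False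
    then obtain m where r: "r = m + t" by (metis add.commute le_iff_add not_less)
    have "card (Mrt_ground (m + t) t) = t + 2 * card (Mrt_ground m t)"
    proof -
      \<comment> \<open>Writing the power as a successor removes the truncated subtraction from the
        closed form.\<close>
      have "(1::nat) \<le> 2 ^ (m div t)" by simp
      then obtain a where a: "2 ^ (m div t) = Suc a" by (metis Suc_le_D One_nat_def)
      have "(m + t) div t = Suc (m div t)" "(m + t) mod t = m mod t" using assms by (simp_all add: div_add_self2)
      then show ?thesis using assms by (simp add: card_Mrt_ground a algebra_simps)
    qed
    then show ?thesis using less.IH[of m] extremal_size_add_self[OF assms, of m] assms r by simp
  qed
qed

text \<open>The tangent line to the convex function \<open>2 ^ n\<close> with slope \<open>2 ^ q\<close> touches it exactly
  at \<open>q\<close> and \<open>q + 1\<close>.\<close>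

lemma pow2_tangent:
  fixes n q :: nat
  shows "2 ^ q * (1 + int n - int q) \<le> 2 ^ n"
    and "2 ^ n = 2 ^ q * (1 + int n - int q) \<Longrightarrow> n = q \<or> n = Suc q"
proof -
  have *: "2 ^ q * (1 + int n - int q) \<le> 2 ^ n \<and>
    (2 ^ n = 2 ^ q * (1 + int n - int q) \<longrightarrow> n = q \<or> n = Suc q)"
  proof (cases "q \<le> n")
    case True
    then obtain k where n: "n = q + k" using le_Suc_ex by blast
    have k: "int k + 1 \<le> 2 ^ k \<and> (int k + 1 = 2 ^ k \<longrightarrow> k = 0 \<or> k = 1)"
    proof (induction k)
      case (Suc k)
      then show ?case by (cases k) auto
    qed simp
    have "(2::int) ^ n = 2 ^ q * 2 ^ k" using n by (simp add: power_add)
    moreover have "2 ^ q * (1 + int n - int q) = 2 ^ q * (int k + 1)" using n by simp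
    ultimately show ?thesis using k n by auto
  next
    case False
    then have "2 ^ q * (1 + int n - int q) \<le> 0" by (simp add: mult_le_0_iff)
    moreover have "(0::int) < 2 ^ n" by simp
    ultimately show ?thesis by linarith
  qed
  then show "2 ^ q * (1 + int n - int q) \<le> 2 ^ n"
    and "2 ^ n = 2 ^ q * (1 + int n - int q) \<Longrightarrow> n = q \<or> n = Suc q" by blast+
qed

text \<open>In the proof, \<open>u\<close> is the excess of a class over \<open>2 ^ n a - 1\<close>,
  and \<open>v\<close> is the gap between \<open>2 ^ n a\<close> and its tangent at
  \<open>q\<close>. Both are nonnegative on \<open>A\<close>, while their total is
  \<open>2 ^ q\<close> times \<open>r\<close> minus the rank sum, hence at most zero; so all of them
  vanish. The computation is over the integers because the tangent may be negative.\<close>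

lemma balanced_if_minimal:
  fixes n c :: "'b \<Rightarrow> nat"
  assumes "finite A" "card A = t" "0 < t"
    and rank: "r \<le> (\<Sum>a\<in>A. n a)"
    and size: "\<And>a. a \<in> A \<Longrightarrow> 2 ^ n a - 1 \<le> c a"
    and total: "(\<Sum>a\<in>A. c a) = card (Mrt_ground r t)"
  shows "(\<Sum>a\<in>A. n a) = r" and "\<And>a. a \<in> A \<Longrightarrow> c a = 2 ^ n a - 1"
    and "\<And>a. a \<in> A \<Longrightarrow> n a = r div t \<or> n a = Suc (r div t)"
proof -
  define q where "q = r div t"
  define u where "u a = int (c a) + 1 - 2 ^ n a" for a
  define v where "v a = 2 ^ n a - 2 ^ q * (1 + int (n a) - int q)" for a
  have u0: "0 \<le> u a" if "a \<in> A" for a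
  proof -
    have "int (2 ^ n a) \<le> int (c a + 1)" using size[OF that] by linarith
    then show ?thesis unfolding u_def by simp
  qed
  have v0: "0 \<le> v a" for a unfolding v_def using pow2_tangent(1)[of q "n a"] by linarith
  have "(1::nat) \<le> 2 ^ q" by simp
  then have "int (card (Mrt_ground r t)) = int t * (2 ^ q - 1) + int (r mod t) * 2 ^ q"
    unfolding card_Mrt_ground[OF assms(3)] q_def by (simp add: of_nat_diff)
  also have "int (r mod t) = int r - int t * int q"
    unfolding q_def by (metis of_nat_mult of_nat_diff minus_mult_div_eq_mod times_div_less_eq_dividend)
  finally have tot: "(\<Sum>a\<in>A. int (c a)) = int t * (2 ^ q - 1) + (int r - int t * int q) * 2 ^ q"
    using total by (simp flip: of_nat_sum)
  \<comment> \<open>The exponentials \<open>2 ^ n a\<close> cancel in \<open>u a + v a\<close>, so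
    the sum depends only on the total size and the total rank.\<close>
  have "(\<Sum>a\<in>A. u a + v a) = (\<Sum>a\<in>A. int (c a) + 1 - 2 ^ q * (1 + int (n a) - int q))"
    unfolding u_def v_def by (rule sum.cong) simp_all
  also have "\<dots> = (\<Sum>a\<in>A. int (c a) + (1 - 2 ^ q + 2 ^ q * int q) - 2 ^ q * int (n a))"
    by (simp add: algebra_simps)
  also have "\<dots> = (\<Sum>a\<in>A. int (c a)) + int t * (1 - 2 ^ q + 2 ^ q * int q) - 2 ^ q * (\<Sum>a\<in>A. int (n a))"
    using assms(2) by (simp add: sum.distrib sum_subtractf sum_distrib_left)
  also have "\<dots> = 2 ^ q * (int r - (\<Sum>a\<in>A. int (n a)))"
    unfolding tot by (simp add: algebra_simps)
  finally have key: "(\<Sum>a\<in>A. u a + v a) = 2 ^ q * (int r - (\<Sum>a\<in>A. int (n a)))" .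
  have ge: "0 \<le> (\<Sum>a\<in>A. u a + v a)" using u0 v0 by (intro sum_nonneg) (simp add: add_nonneg_nonneg)
  have "int r \<le> (\<Sum>a\<in>A. int (n a))" using rank by (simp flip: of_nat_sum)
  then have le: "2 ^ q * (int r - (\<Sum>a\<in>A. int (n a))) \<le> 0" by (simp add: mult_le_0_iff)
  then have "2 ^ q * (int r - (\<Sum>a\<in>A. int (n a))) = 0" using key ge by linarith
  then have "int r = (\<Sum>a\<in>A. int (n a))" by simp
  then show "(\<Sum>a\<in>A. n a) = r" by (metis of_nat_eq_iff of_nat_sum)
  have "u a + v a = 0" if "a \<in> A" for a
  proof -
    have "(\<Sum>a\<in>A. u a + v a) = 0" using key ge le by linarith
    moreover have "0 \<le> u b + v b" if "b \<in> A" for b using u0[OF that] v0[of b] by simp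
    ultimately show ?thesis using that sum_nonneg_eq_0_iff[OF assms(1), of "\<lambda>a. u a + v a"] by blast
  qed
  then have uv: "u a = 0" "v a = 0" if "a \<in> A" for a using u0[OF that] v0[of a] that by force+
  show "c a = 2 ^ n a - 1" if "a \<in> A" for a
  proof -
    have "int (c a + 1) = int (2 ^ n a)" using uv(1)[OF that] unfolding u_def by simp
    then show ?thesis by linarith
  qed
  show "n a = r div t \<or> n a = Suc (r div t)" if "a \<in> A" for a
    using uv(2)[OF that] pow2_tangent(2)[of "n a" q] unfolding v_def q_def by simp
qed

text \<open>As the ranks sum to \<open>r\<close>, exactly \<open>r mod t\<close> of them take the
  larger value; these are numbered first because \<open>comp_rank\<close> gives the larger rank to
  the smallest indices.\<close>

lemma comp_rank_enumeration:
  fixes n :: "'b \<Rightarrow> nat"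
  assumes "finite A" "card A = t" "0 < t" "(\<Sum>a\<in>A. n a) = r"
    and bal: "\<And>a. a \<in> A \<Longrightarrow> n a = r div t \<or> n a = Suc (r div t)"
  obtains g where "bij_betw g A {..<t}" "\<And>a. a \<in> A \<Longrightarrow> comp_rank r t (g a) = n a"
proof -
  let ?q = "r div t" and ?m = "r mod t"
  define A1 where "A1 = {a \<in> A. n a = Suc ?q}"
  have "n a = ?q + (if a \<in> A1 then 1 else 0)" if "a \<in> A" for a
    using bal[OF that] that unfolding A1_def by auto
  then have "r = (\<Sum>a\<in>A. ?q + (if a \<in> A1 then 1 else 0))" using assms(4) by simp
  also have "\<dots> = t * ?q + (\<Sum>a\<in>A. if a \<in> A1 then 1 else 0)"
    using assms(2) by (simp add: sum.distrib)
  also have "(\<Sum>a\<in>A. if a \<in> A1 then 1 else 0) = card A1"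
    using assms(1) unfolding A1_def by (simp flip: sum.inter_filter)
  finally have "card A1 = ?m" using mult_div_mod_eq[of t r] by linarith
  then obtain g1 where g1: "bij_betw g1 A1 {..<?m}"
    using finite_same_card_bij[of A1 "{..<?m}"] assms(1) unfolding A1_def by auto
  have m: "?m < t" using assms(3) by simp
  have "card (A - A1) = card {?m..<t}"
    using \<open>card A1 = ?m\<close> assms(1,2) by (simp add: A1_def card_Diff_subset)
  then obtain g2 where g2: "bij_betw g2 (A - A1) {?m..<t}"
    using finite_same_card_bij[of "A - A1" "{?m..<t}"] assms(1) by auto
  define g where "g a = (if a \<in> A1 then g1 a else g2 a)" for a
  have "bij_betw g A1 {..<?m}" using g1 bij_betw_cong[of A1 g g1] unfolding g_def by simp
  moreover have "bij_betw g (A - A1) {?m..<t}"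
    using g2 bij_betw_cong[of "A - A1" g g2] unfolding g_def by simp
  ultimately have "bij_betw g (A1 \<union> (A - A1)) ({..<?m} \<union> {?m..<t})"
    by (rule bij_betw_combine) auto
  moreover have "A1 \<union> (A - A1) = A" unfolding A1_def by blast
  moreover have "{..<?m} \<union> {?m..<t} = {..<t}" using m by auto
  ultimately have "bij_betw g A {..<t}" by simp
  moreover have "comp_rank r t (g a) = n a" if a: "a \<in> A" for a
  proof (cases "a \<in> A1")
    case True
    then have "g a < ?m" using g1 unfolding g_def bij_betw_def by auto
    then show ?thesis using True unfolding comp_rank_def A1_def by simp
  next
    case False
    then have "?m \<le> g a" using g2 a unfolding g_def bij_betw_def by auto
    moreover have "n a = ?q" using bal[OF a] False a unfolding A1_def by auto
    ultimately show ?thesis unfolding comp_rank_def by simp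
  qed
  ultimately show ?thesis using that by blast
qed

section \<open>Closure\<close>

locale indep_matroid =
  fixes E :: "'a set" and indep :: "'a set \<Rightarrow> bool"
  assumes matroid: "matroid E indep"
begin

abbreviation rk :: "'a set \<Rightarrow> nat" where "rk \<equiv> mrank E indep"
abbreviation cl :: "'a set \<Rightarrow> 'a set" where "cl \<equiv> mclosure E indep"

lemma finite_E: "finite E"
  and indep_subset_E: "indep X \<Longrightarrow> X \<subseteq> E"
  and indep_empty: "indep {}"
  and indep_mono: "indep X \<Longrightarrow> Y \<subseteq> X \<Longrightarrow> indep Y"
  and indep_augment: "indep X \<Longrightarrow> indep Y \<Longrightarrow> card X < card Y \<Longrightarrow> \<exists>y\<in>Y - X. indep (insert y X)"
  using matroid unfolding matroid_def by blast+

lemma indep_finite: "indep X \<Longrightarrow> finite X"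
  using finite_E indep_subset_E finite_subset by blast

definition basis_of :: "'a set \<Rightarrow> 'a set \<Rightarrow> bool" where
  "basis_of X B \<longleftrightarrow> B \<subseteq> X \<and> indep B \<and> (\<forall>x\<in>X - B. \<not> indep (insert x B))"

lemma finite_indep_cards: "finite {card Y | Y. Y \<subseteq> X \<and> indep Y}"
proof (rule finite_subset)
  show "{card Y | Y. Y \<subseteq> X \<and> indep Y} \<subseteq> card ` Pow E"
    using indep_subset_E by blast
qed (simp add: finite_E)

lemma indep_card_le_rk: "Y \<subseteq> X \<Longrightarrow> indep Y \<Longrightarrow> card Y \<le> rk X"
  unfolding mrank_def by (rule Max_ge[OF finite_indep_cards]) blast

lemma basis_of_card:
  assumes "basis_of X B" shows "card B = rk X"
proof (rule antisym)
  show "card B \<le> rk X"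
    using assms indep_card_le_rk unfolding basis_of_def by blast
  have "card Y \<le> card B" if Y: "Y \<subseteq> X" "indep Y" for Y
  proof (rule ccontr)
    assume "\<not> card Y \<le> card B"
    moreover have "indep B" using assms unfolding basis_of_def by blast
    ultimately obtain y where "y \<in> Y - B" "indep (insert y B)"
      using indep_augment[of B Y] Y(2) by (meson not_le)
    then show False using assms Y unfolding basis_of_def by blast
  qed
  then show "rk X \<le> card B"
    unfolding mrank_def using indep_empty
    by (subst Max_le_iff[OF finite_indep_cards]) auto
qed

lemma basis_extension:
  assumes "indep I" "I \<subseteq> X" obtains B where "I \<subseteq> B" "basis_of X B"
proof -
  let ?F = "{B. I \<subseteq> B \<and> B \<subseteq> X \<and> indep B}"
  have "finite ?F"
    by (rule finite_subset[of _ "Pow E"]) (use indep_subset_E finite_E in auto)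
  moreover have "I \<in> ?F" using assms by blast
  ultimately obtain B where B: "B \<in> ?F" "\<And>B'. B' \<in> ?F \<Longrightarrow> B \<subseteq> B' \<Longrightarrow> B' = B"
    by (metis (no_types, lifting) finite_has_maximal2)
  have "basis_of X B"
    unfolding basis_of_def
  proof (intro conjI ballI notI)
    fix x assume "x \<in> X - B" "indep (insert x B)"
    then have "insert x B \<in> ?F" using B(1) by blast
    then show False using B(2)[of "insert x B"] \<open>x \<in> X - B\<close> by blast
  qed (use B in auto)
  then show ?thesis using that B(1) by blast
qed

lemma basis_exists: obtains B where "basis_of X B"
  using basis_extension[OF indep_empty] by blast

text \<open>If \<open>x\<close> properly extends \<open>B\<close>, the rank rises; otherwise
  \<open>B\<close> is still a basis of \<open>insert x X\<close>. This turns the rank definition of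
  closure into a condition on independence.\<close>

lemma cl_iff_basis:
  assumes B: "basis_of X B"
  shows "x \<in> cl X \<longleftrightarrow> x \<in> E \<and> (x \<in> B \<or> \<not> indep (insert x B))"
proof -
  have "rk (insert x X) = rk X \<longleftrightarrow> x \<in> B \<or> \<not> indep (insert x B)"
  proof (cases "x \<in> B \<or> \<not> indep (insert x B)")
    case True
    then have "basis_of (insert x X) B" using B unfolding basis_of_def by blast
    then show ?thesis using True basis_of_card B by metis
  next
    case False
    then have "card (insert x B) \<le> rk (insert x X)"
      using B indep_card_le_rk[of "insert x B" "insert x X"] unfolding basis_of_def by blast
    moreover have "card (insert x B) = Suc (rk X)"
      using False B basis_of_card[OF B] indep_finite unfolding basis_of_def by simp
    ultimately show ?thesis using False by linarith
  qed
  then show ?thesis unfolding mclosure_def by blast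
qed

lemma cl_indep: "indep I \<Longrightarrow> x \<in> cl I \<longleftrightarrow> x \<in> E \<and> (x \<in> I \<or> \<not> indep (insert x I))"
  by (rule cl_iff_basis) (simp add: basis_of_def)

lemma cl_basis: "basis_of X B \<Longrightarrow> cl X = cl B"
  using cl_iff_basis cl_indep unfolding basis_of_def by blast

lemma cl_subset_E: "cl X \<subseteq> E"
  unfolding mclosure_def by blast

lemma finite_cl: "finite (cl X)"
  using cl_subset_E finite_E finite_subset by blast

lemma cl_mono: assumes "X \<subseteq> Y" shows "cl X \<subseteq> cl Y"
proof -
  obtain A where A: "basis_of X A" by (rule basis_exists)
  then have "indep A" "A \<subseteq> Y" using assms unfolding basis_of_def by auto
  then obtain B where B: "A \<subseteq> B" "basis_of Y B" by (rule basis_extension)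
  show ?thesis
  proof
    fix x assume "x \<in> cl X"
    then have "x \<in> E" "x \<in> A \<or> \<not> indep (insert x A)" using cl_iff_basis[OF A] by auto
    moreover have "insert x A \<subseteq> insert x B" using B(1) by blast
    ultimately show "x \<in> cl Y" using cl_iff_basis[OF B(2)] B(1) indep_mono by blast
  qed
qed

lemma subset_cl: assumes "X \<subseteq> E" shows "X \<subseteq> cl X"
proof -
  obtain B where "basis_of X B" by (rule basis_exists)
  then show ?thesis using cl_iff_basis assms unfolding basis_of_def by blast
qed

lemma basis_of_cl: assumes "basis_of X B" shows "basis_of (cl X) B"
  using assms cl_iff_basis[OF assms] indep_subset_E unfolding basis_of_def by blast

lemma cl_cl: "cl (cl X) = cl X"
proof -
  obtain B where "basis_of X B" by (rule basis_exists)
  then show ?thesis using basis_of_cl cl_basis by metis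
qed

lemma cl_least: "X \<subseteq> cl Y \<Longrightarrow> cl X \<subseteq> cl Y"
  using cl_mono cl_cl by blast

lemma indep_insert_iff:
  "indep I \<Longrightarrow> x \<in> E \<Longrightarrow> x \<notin> I \<Longrightarrow> indep (insert x I) \<longleftrightarrow> x \<notin> cl I"
  using cl_indep by blast

lemma card_indep_le_span:
  assumes "indep I" "indep J" "I \<subseteq> cl J" shows "card I \<le> card J"
proof -
  have "basis_of (cl J) J" using assms(2) by (intro basis_of_cl) (simp add: basis_of_def)
  then show ?thesis using basis_of_card indep_card_le_rk[OF assms(3,1)] by simp
qed

text \<open>A basis of \<open>A\<close> spans \<open>J\<close>, so it has at least
  \<open>card J \<ge> card A\<close> elements and is all of \<open>A\<close>.\<close>

lemma indep_if_spans:
  assumes "indep J" "J \<subseteq> cl A" "finite A" "card A \<le> card J"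
  shows "indep A"
proof -
  obtain B where B: "basis_of A B" by (rule basis_exists)
  then have "card J \<le> card B"
    using card_indep_le_span[OF assms(1), of B] cl_basis[OF B] assms(2) unfolding basis_of_def by simp
  then have "B = A"
    using card_seteq[OF assms(3), of B] B assms(4) unfolding basis_of_def by simp
  then show ?thesis using B unfolding basis_of_def by simp
qed

section \<open>Exchange, modular intersection and supports\<close>

lemma indep_notin_cl: "indep (insert x I) \<Longrightarrow> x \<notin> I \<Longrightarrow> x \<notin> cl I"
  using cl_indep[of I x] indep_mono[of "insert x I" I] by blast

lemma cl_Int_indep: "indep B \<Longrightarrow> X \<subseteq> B \<Longrightarrow> cl X \<inter> B = X"
proof
  assume B: "indep B" and X: "X \<subseteq> B"
  show "cl X \<inter> B \<subseteq> X"
  proof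
    fix z assume z: "z \<in> cl X \<inter> B"
    show "z \<in> X"
    proof (rule ccontr)
      assume "z \<notin> X"
      moreover have "indep (insert z X)" using B X z indep_mono by (metis IntE insert_subset)
      ultimately show False using indep_notin_cl z by blast
    qed
  qed
  show "X \<subseteq> cl X \<inter> B" using subset_cl[of X] indep_subset_E[OF B] X by blast
qed

lemma cl_exchange:
  assumes "x \<in> cl (insert y X)" "x \<notin> cl X" "y \<in> E" "X \<subseteq> E"
  shows "y \<in> cl (insert x X)"
proof -
  obtain A where A: "basis_of X A" by (rule basis_exists)
  have iA: "indep A" "A \<subseteq> X" using A unfolding basis_of_def by auto
  have xE: "x \<in> E" using assms(1) cl_subset_E by blast
  have xA: "indep (insert x A)" "x \<notin> A" using cl_iff_basis[OF A] assms(2) xE by auto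
  have "X \<subseteq> cl A" using cl_basis[OF A] subset_cl assms(4) by blast
  then have "insert y X \<subseteq> cl (insert y A)"
    using cl_mono[of A "insert y A"] subset_cl[of "insert y A"] assms(3) iA(2) assms(4) by blast
  then have xy: "x \<in> cl (insert y A)" using assms(1) cl_least by blast
  show ?thesis
  proof (rule ccontr)
    assume "y \<notin> cl (insert x X)"
    then have y: "y \<notin> cl (insert x A)" using cl_mono[of "insert x A" "insert x X"] iA by blast
    then have "y \<notin> insert x A" using subset_cl[of "insert x A"] xE iA(2) assms(4) by blast
    then have "indep (insert y (insert x A))" using indep_insert_iff[OF xA(1) assms(3)] y by blast
    then have "indep (insert x (insert y A))" by (simp add: insert_commute)
    then show False using indep_notin_cl[of x "insert y A"] xy \<open>y \<notin> insert x A\<close> xA(2) by blast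
  qed
qed

text \<open>If \<open>z\<close> lies in both closures but not in \<open>cl (X \<inter> Y)\<close>,
  then some \<open>a \<in> X - Y\<close> can be exchanged for \<open>z\<close>:
  \<open>insert z (B - {a})\<close> still spans \<open>B\<close> and is therefore independent. It
  contains \<open>insert z Y\<close>, against \<open>z \<in> cl Y\<close>.\<close>

lemma cl_modular:
  assumes "indep B" "X \<subseteq> B" "Y \<subseteq> B"
  shows "cl X \<inter> cl Y = cl (X \<inter> Y)"
proof
  show "cl (X \<inter> Y) \<subseteq> cl X \<inter> cl Y" using cl_mono by (metis Int_lower1 Int_lower2 le_inf_iff)
  have BE: "B \<subseteq> E" using assms(1) indep_subset_E by blast
  show "cl X \<inter> cl Y \<subseteq> cl (X \<inter> Y)"
  proof (rule ccontr)
    assume "\<not> cl X \<inter> cl Y \<subseteq> cl (X \<inter> Y)"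
    then obtain z where z: "z \<in> cl X" "z \<in> cl Y" "z \<notin> cl (X \<inter> Y)" by blast
    have zE: "z \<in> E" using z(1) cl_subset_E by blast
    have iXY: "indep (X \<inter> Y)" "indep X" "indep Y" using assms indep_mono by blast+
    have zXY: "z \<notin> X \<inter> Y" using z(3) subset_cl[of "X \<inter> Y"] BE assms by blast
    have zB: "z \<notin> B" using cl_Int_indep[OF assms(1,2)] cl_Int_indep[OF assms(1,3)] z zXY by blast
    have i1: "indep (insert z (X \<inter> Y))" using indep_insert_iff[OF iXY(1) zE zXY] z(3) by blast
    obtain D where D: "insert z (X \<inter> Y) \<subseteq> D" "basis_of (insert z X) D"
      using basis_extension[OF i1, of "insert z X"] by blast
    have "D \<noteq> insert z X"
      using D(2) z(1) zB assms(2) indep_notin_cl[of z X] unfolding basis_of_def by blast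
    then obtain a where a: "a \<in> X" "a \<notin> D" using D unfolding basis_of_def by blast
    have aY: "a \<notin> Y" using a D by blast
    let ?A = "insert z (B - {a})"
    have DA: "D \<subseteq> ?A" using a D(2) assms(2) unfolding basis_of_def by blast
    have "X \<subseteq> cl D"
      using cl_basis[OF D(2)] subset_cl[of "insert z X"] zE BE assms(2) by blast
    then have "X \<subseteq> cl ?A" using cl_mono[OF DA] by blast
    moreover have "B - {a} \<subseteq> cl ?A" using subset_cl[of ?A] zE BE by blast
    ultimately have "B \<subseteq> cl ?A" using a by blast
    moreover have "card ?A \<le> card B"
      using zB a(1) assms(2) indep_finite[OF assms(1)]
      by (metis DiffD1 card.remove card_insert_disjoint finite_Diff order_refl subsetD)
    ultimately have "indep ?A" using indep_if_spans[OF assms(1)] indep_finite[OF assms(1)] by blast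
    then have "indep (insert z Y)" using indep_mono[of ?A "insert z Y"] aY assms(3) by blast
    then show False using indep_notin_cl z(2) zB assms(3) by blast
  qed
qed

text \<open>For independent \<open>B\<close> and \<open>x \<in> cl B - B\<close> this is the
  fundamental circuit of \<open>x\<close> with respect to \<open>B\<close>, without \<open>x\<close>
  itself; for \<open>x \<in> B\<close> it is \<open>{x}\<close>. The form by hyperplanes avoids a
  theory of circuits.\<close>

definition supp :: "'a set \<Rightarrow> 'a \<Rightarrow> 'a set" where
  "supp B x = {b \<in> B. x \<notin> cl (B - {b})}"

text \<open>For the harder direction take a minimal \<open>D \<subseteq> B\<close> that spans
  \<open>x\<close>: by \<open>cl_modular\<close>, no \<open>d \<in> D\<close> has
  \<open>x \<in> cl (B - {d})\<close>, so \<open>D\<close> is contained in the support.\<close>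

lemma in_cl_iff_supp:
  assumes B: "indep B" and x: "x \<in> cl B" and A: "A \<subseteq> B"
  shows "x \<in> cl A \<longleftrightarrow> supp B x \<subseteq> A"
proof
  assume xA: "x \<in> cl A"
  show "supp B x \<subseteq> A"
  proof
    fix b assume b: "b \<in> supp B x"
    then show "b \<in> A"
      using cl_mono[of A "B - {b}"] xA A unfolding supp_def by blast
  qed
next
  assume sA: "supp B x \<subseteq> A"
  let ?F = "{D. D \<subseteq> B \<and> x \<in> cl D}"
  have "finite ?F" using indep_finite[OF B] by simp
  moreover have "B \<in> ?F" using x by blast
  ultimately obtain D where D: "D \<in> ?F" "\<And>D'. D' \<in> ?F \<Longrightarrow> D' \<subseteq> D \<Longrightarrow> D = D'"
    by (metis (no_types, lifting) finite_has_minimal2)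
  have "D \<subseteq> supp B x"
  proof
    fix d assume d: "d \<in> D"
    have "x \<notin> cl (B - {d})"
    proof
      assume "x \<in> cl (B - {d})"
      then have "x \<in> cl (D \<inter> (B - {d}))" using cl_modular[OF B, of D "B - {d}"] D(1) by blast
      then have "D \<inter> (B - {d}) \<in> ?F" by blast
      then show False using D(2)[of "D \<inter> (B - {d})"] d by blast
    qed
    then show "d \<in> supp B x" using d D(1) unfolding supp_def by blast
  qed
  then have "cl D \<subseteq> cl A" using sA cl_mono by blast
  then show "x \<in> cl A" using D(1) by blast
qed

section \<open>Ranks of unions, and direct sums\<close>

lemma card_indep_le_span_card:
  assumes "indep I" "I \<subseteq> cl A" "finite A" shows "card I \<le> card A"
proof -
  obtain B where B: "basis_of A B" by (rule basis_exists)
  then have "indep B" "B \<subseteq> A" unfolding basis_of_def by auto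
  have "card I \<le> card B"
    using card_indep_le_span[OF assms(1) \<open>indep B\<close>] cl_basis[OF B] assms(2) by simp
  also have "\<dots> \<le> card A" using card_mono[OF assms(3) \<open>B \<subseteq> A\<close>] .
  finally show ?thesis .
qed

lemma cl_Un_bases:
  assumes "E = (\<Union>s\<in>S. C s)" "\<And>s. s \<in> S \<Longrightarrow> basis_of (C s) (B s)"
  shows "cl (\<Union>s\<in>S. B s) = E"
proof
  show "E \<subseteq> cl (\<Union>s\<in>S. B s)"
  proof
    fix x assume "x \<in> E"
    then obtain s where s: "s \<in> S" "x \<in> C s" using assms(1) by blast
    then have "C s \<subseteq> cl (B s)" using assms cl_basis subset_cl[of "C s"] by (metis UN_upper)
    moreover have "cl (B s) \<subseteq> cl (\<Union>s\<in>S. B s)" using s by (intro cl_mono) blast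
    ultimately show "x \<in> cl (\<Union>s\<in>S. B s)" using s by blast
  qed
qed (rule cl_subset_E)

lemma rk_le_sum:
  assumes "E = (\<Union>s\<in>S. C s)" "finite S" shows "rk E \<le> (\<Sum>s\<in>S. rk (C s))"
proof -
  have "\<forall>s. \<exists>B. basis_of (C s) B" using basis_exists by metis
  then obtain B where B: "\<And>s. basis_of (C s) (B s)" by metis
  obtain J where J: "basis_of E J" by (rule basis_exists)
  have fin: "finite (\<Union>s\<in>S. B s)" using B assms(2) indep_finite unfolding basis_of_def by blast
  have "rk E = card J" using basis_of_card[OF J] by simp
  also have "\<dots> \<le> card (\<Union>s\<in>S. B s)"
    using card_indep_le_span_card[OF _ _ fin, of J] J cl_Un_bases[OF assms(1) B]
    unfolding basis_of_def by simp
  also have "\<dots> \<le> (\<Sum>s\<in>S. card (B s))" using card_UN_le[OF assms(2)] .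
  also have "\<dots> = (\<Sum>s\<in>S. rk (C s))" using basis_of_card[OF B] by simp
  finally show ?thesis .
qed

text \<open>Extend every trace \<open>X \<inter> C s\<close> to a basis of \<open>C s\<close>. The
  union of these bases spans \<open>E\<close> and by the rank equation has at most
  \<open>rk E\<close> elements, so it is independent.\<close>

lemma indep_direct_sum:
  assumes E: "E = (\<Union>s\<in>S. C s)" "finite S" and rk: "(\<Sum>s\<in>S. rk (C s)) = rk E" and X: "X \<subseteq> E"
  shows "indep X \<longleftrightarrow> (\<forall>s\<in>S. indep (X \<inter> C s))"
proof
  assume "\<forall>s\<in>S. indep (X \<inter> C s)"
  then have "\<forall>s\<in>S. \<exists>B. X \<inter> C s \<subseteq> B \<and> basis_of (C s) B" using basis_extension by (metis inf_le2)
  then obtain B where B: "\<And>s. s \<in> S \<Longrightarrow> X \<inter> C s \<subseteq> B s" "\<And>s. s \<in> S \<Longrightarrow> basis_of (C s) (B s)"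
    by metis
  obtain J where J: "basis_of E J" by (rule basis_exists)
  have "indep (\<Union>s\<in>S. B s)"
  proof (rule indep_if_spans)
    show "indep J" "J \<subseteq> cl (\<Union>s\<in>S. B s)"
      using J cl_Un_bases[OF E(1) B(2)] unfolding basis_of_def by auto
    show "finite (\<Union>s\<in>S. B s)" using B(2) E(2) indep_finite unfolding basis_of_def by blast
    have "card (\<Union>s\<in>S. B s) \<le> (\<Sum>s\<in>S. card (B s))" using card_UN_le[OF E(2)] .
    also have "\<dots> = (\<Sum>s\<in>S. rk (C s))" using basis_of_card[OF B(2)] by (intro sum.cong) auto
    also note rk
    finally show "card (\<Union>s\<in>S. B s) \<le> card J" using basis_of_card[OF J] by simp
  qed
  moreover have "X \<subseteq> (\<Union>s\<in>S. B s)" using X E(1) B(1) by blast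
  ultimately show "indep X" by (rule indep_mono)
qed (use indep_mono in blast)

section \<open>Claws of contractions\<close>

text \<open>For independent \<open>I\<close>, \<open>relative_claw I X\<close> says that \<open>X\<close> represents a claw of the
  simplification of the contraction of \<open>I\<close>, and \<open>points_over I\<close> is the set of points of that
  simplification, each given as a flat of rank \<open>card I + 1\<close>.\<close>

definition relative_claw :: "'a set \<Rightarrow> 'a set \<Rightarrow> bool" where
  "relative_claw I X \<longleftrightarrow>
     indep (I \<union> X) \<and> I \<inter> X = {} \<and> cl (I \<union> X) \<subseteq> cl I \<union> (\<Union>x\<in>X. cl (insert x I))"

definition points_over :: "'a set \<Rightarrow> 'a set set" where
  "points_over I = (\<lambda>x. cl (insert x I)) ` (E - cl I)"

definition maximal_relative_claw :: "'a set \<Rightarrow> 'a set \<Rightarrow> bool" where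
  "maximal_relative_claw I X \<longleftrightarrow>
     relative_claw I X \<and> (\<forall>y. y \<notin> X \<longrightarrow> \<not> relative_claw I (insert y X))"

text \<open>For \<open>I \<subseteq> J\<close> and a point \<open>Q\<close> over \<open>J\<close>,
  these are the points over \<open>I\<close> that become parallel and merge into \<open>Q\<close>
  when \<open>J\<close> is contracted.\<close>

definition points_between :: "'a set \<Rightarrow> 'a set \<Rightarrow> 'a set \<Rightarrow> 'a set set" where
  "points_between I J Q = {p \<in> points_over I. p \<subseteq> Q \<and> \<not> p \<subseteq> cl J}"

text \<open>Inside the independent set \<open>J \<union> Y\<close>, \<open>cl_modular\<close> cuts
  \<open>cl J\<close> and \<open>cl (insert y J)\<close> down to \<open>cl I\<close> and
  \<open>cl (insert y I)\<close> on \<open>cl (I \<union> Y)\<close>. Hence the absence of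
  \<open>(t + 1)\<close>-claws is inherited by contractions.\<close>

lemma relative_claw_antimono:
  assumes "relative_claw J Y" "I \<subseteq> J" shows "relative_claw I Y"
proof -
  have ind: "indep (J \<union> Y)" "J \<inter> Y = {}" "cl (J \<union> Y) \<subseteq> cl J \<union> (\<Union>y\<in>Y. cl (insert y J))"
    using assms(1) unfolding relative_claw_def by auto
  have sub: "I \<union> Y \<subseteq> J \<union> Y" using assms(2) by blast
  have "cl (I \<union> Y) \<subseteq> cl I \<union> (\<Union>x\<in>Y. cl (insert x I))"
  proof
    fix z assume z: "z \<in> cl (I \<union> Y)"
    then have "z \<in> cl (J \<union> Y)" using cl_mono[OF sub] by blast
    then consider "z \<in> cl J" | y where "y \<in> Y" "z \<in> cl (insert y J)" using ind(3) by blast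
    then show "z \<in> cl I \<union> (\<Union>x\<in>Y. cl (insert x I))"
    proof cases
      case 1
      moreover have "(I \<union> Y) \<inter> J = I" using assms(2) ind(2) by blast
      ultimately have "z \<in> cl I"
        using z cl_modular[OF ind(1) sub, of J] by auto
      then show ?thesis by blast
    next
      case 2
      moreover have "(I \<union> Y) \<inter> insert y J = insert y I" using assms(2) ind(2) 2 by blast
      moreover have "insert y J \<subseteq> J \<union> Y" using 2 by blast
      ultimately have "z \<in> cl (insert y I)"
        using z cl_modular[OF ind(1) sub, of "insert y J"] by auto
      then show ?thesis using 2 by blast
    qed
  qed
  then show ?thesis using ind sub assms(2) indep_mono unfolding relative_claw_def by blast
qed

text \<open>By \<open>cl_modular\<close>, a point \<open>cl (insert x I)\<close> with
  \<open>x \<in> X - Y\<close> meets \<open>cl (I \<union> Y)\<close> only in \<open>cl I\<close>.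
  This lets a claw with more than \<open>t\<close> elements be cut down to exactly
  \<open>t + 1\<close>.\<close>

lemma relative_claw_subset:
  assumes "relative_claw I X" "Y \<subseteq> X" shows "relative_claw I Y"
proof -
  have ind: "indep (I \<union> X)" "I \<inter> X = {}" "cl (I \<union> X) \<subseteq> cl I \<union> (\<Union>x\<in>X. cl (insert x I))"
    using assms(1) unfolding relative_claw_def by auto
  have sub: "I \<union> Y \<subseteq> I \<union> X" using assms(2) by blast
  have "cl (I \<union> Y) \<subseteq> cl I \<union> (\<Union>x\<in>Y. cl (insert x I))"
  proof
    fix z assume z: "z \<in> cl (I \<union> Y)"
    then have "z \<in> cl (I \<union> X)" using cl_mono[OF sub] by blast
    then consider "z \<in> cl I" | x where "x \<in> X" "z \<in> cl (insert x I)" using ind(3) by blast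
    then show "z \<in> cl I \<union> (\<Union>x\<in>Y. cl (insert x I))"
    proof cases
      case 2
      show ?thesis
      proof (cases "x \<in> Y")
        case False
        then have "(I \<union> Y) \<inter> insert x I = I" using assms(2) 2 ind(2) by blast
        moreover have "insert x I \<subseteq> I \<union> X" using 2 by blast
        ultimately have "z \<in> cl I"
          using z 2 cl_modular[OF ind(1) sub, of "insert x I"] by auto
        then show ?thesis by blast
      qed (use 2 in blast)
    qed blast
  qed
  then show ?thesis using ind sub assms(2) indep_mono unfolding relative_claw_def by blast
qed

lemma relative_claw_singleton:
  assumes "indep I" "x \<in> E" "x \<notin> cl I" shows "relative_claw I {x}"
proof -
  have "x \<notin> I" using assms subset_cl[OF indep_subset_E] by blast
  then show ?thesis using assms indep_insert_iff unfolding relative_claw_def by auto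
qed

lemma maximal_relative_claw_exists:
  assumes "relative_claw I Y" obtains X where "Y \<subseteq> X" "maximal_relative_claw I X"
proof -
  let ?F = "{X. relative_claw I X}"
  have "finite ?F"
    by (rule finite_subset[of _ "Pow E"])
      (use indep_subset_E finite_E in \<open>auto simp: relative_claw_def\<close>)
  moreover have "Y \<in> ?F" using assms by blast
  ultimately obtain X where X: "X \<in> ?F" "Y \<subseteq> X" "\<And>Z. Z \<in> ?F \<Longrightarrow> X \<subseteq> Z \<Longrightarrow> X = Z"
    by (metis (no_types, lifting) finite_has_maximal2)
  have "\<not> relative_claw I (insert y X)" if "y \<notin> X" for y
    using X(3)[of "insert y X"] that by blast
  then have "maximal_relative_claw I X" using X(1) unfolding maximal_relative_claw_def by blast
  then show ?thesis using that X(2) by blast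
qed

lemma cl_insert_eq:
  assumes "z \<in> cl (insert y X)" "z \<notin> cl X" "y \<in> E" "X \<subseteq> E"
  shows "cl (insert z X) = cl (insert y X)"
proof
  show "cl (insert z X) \<subseteq> cl (insert y X)"
    using assms(1,3,4) subset_cl[of "insert y X"] by (intro cl_least) blast
  have "z \<in> E" using assms(1) cl_subset_E by blast
  then show "cl (insert y X) \<subseteq> cl (insert z X)"
    using cl_exchange[OF assms] subset_cl[of "insert z X"] assms(4) by (intro cl_least) blast
qed

text \<open>Here \<open>par\<close> says that the parallel class of \<open>y\<close> modulo
  \<open>I \<union> X\<close> is a single point over \<open>I\<close>. At a maximal relative claw
  this must fail, which yields a second point in each class.\<close>

lemma relative_claw_extend:
  assumes X: "relative_claw I X" and y: "y \<in> E" "y \<notin> cl (I \<union> X)"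
    and par: "\<And>z. z \<in> cl (insert y (I \<union> X)) \<Longrightarrow> z \<notin> cl (I \<union> X) \<Longrightarrow> z \<in> cl (insert y I)"
  shows "relative_claw I (insert y X)"
proof -
  have ind: "indep (I \<union> X)" "I \<inter> X = {}" "cl (I \<union> X) \<subseteq> cl I \<union> (\<Union>x\<in>X. cl (insert x I))"
    using X unfolding relative_claw_def by auto
  have yn: "y \<notin> I \<union> X" using y subset_cl[OF indep_subset_E[OF ind(1)]] by blast
  have "indep (insert y (I \<union> X))" using indep_insert_iff[OF ind(1) y(1) yn] y(2) by blast
  then show ?thesis using ind yn par unfolding relative_claw_def by auto
qed

section \<open>Counting the points of successive contractions\<close>

lemma finite_points_over: "finite (points_over I)"
  unfolding points_over_def using finite_E by simp

text \<open>The points over \<open>I\<close> inside \<open>cl (I \<union> X)\<close> are exactly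
  those given by \<open>X\<close>, because \<open>X\<close> is a relative claw. Every other point
  over \<open>I\<close> lies in exactly one point over \<open>I \<union> X\<close>.\<close>

lemma card_points_over_eq:
  assumes X: "relative_claw I X"
  shows "card (points_over I) =
    card X + (\<Sum>Q\<in>points_over (I \<union> X). card (points_between I (I \<union> X) Q))"
proof -
  let ?J = "I \<union> X" and ?p = "\<lambda>x. cl (insert x I)"
  have ind: "indep ?J" "I \<inter> X = {}" "cl ?J \<subseteq> cl I \<union> (\<Union>x\<in>X. ?p x)"
    using X unfolding relative_claw_def by auto
  have JE: "?J \<subseteq> E" using indep_subset_E[OF ind(1)] .
  have inj: "inj_on ?p X"
  proof (rule inj_onI)
    fix x y assume xy: "x \<in> X" "y \<in> X" "?p x = ?p y"
    have "cl (insert x I) \<inter> ?J = insert x I" using cl_Int_indep[OF ind(1)] xy by blast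
    moreover have "y \<in> ?p y" using subset_cl[of "insert y I"] JE xy by blast
    ultimately show "x = y" using xy ind(2) by blast
  qed
  have xcl: "x \<in> E - cl I" if "x \<in> X" for x
  proof -
    have "cl I \<inter> ?J = I" using cl_Int_indep[OF ind(1)] by blast
    then show ?thesis using that ind(2) JE by blast
  qed
  have psub: "?p z \<subseteq> cl (insert z ?J)" for z by (rule cl_mono) blast
  have pin: "z \<in> ?p z" if "z \<in> E" for z using subset_cl[of "insert z I"] JE that by blast
  have pJ: "?p z \<subseteq> cl ?J" if "z \<in> cl ?J" for z
    using subset_cl[OF JE] that by (intro cl_least) blast
  \<comment> \<open>A point over \<open>I\<close> outside \<open>cl ?J\<close> generates, together
    with \<open>?J\<close>, the only point over \<open>?J\<close> containing it; this gives the
    disjointness needed for the sum.\<close>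
  have Qeq: "Q = cl (insert z ?J)" if asm: "Q \<in> points_over ?J" "?p z \<in> points_between I ?J Q" "z \<in> E" for Q z
  proof -
    obtain y where y: "y \<in> E" "Q = cl (insert y ?J)" using asm(1) unfolding points_over_def by blast
    have z: "z \<in> Q" "z \<notin> cl ?J" using asm pin pJ unfolding points_between_def by blast+
    show ?thesis using cl_insert_eq[of z y ?J] y z JE by blast
  qed
  have eq: "points_over I = ?p ` X \<union> (\<Union>Q\<in>points_over ?J. points_between I ?J Q)"
  proof
    show "points_over I \<subseteq> ?p ` X \<union> (\<Union>Q\<in>points_over ?J. points_between I ?J Q)"
    proof
      fix p assume p: "p \<in> points_over I"
      then obtain z where z: "z \<in> E" "z \<notin> cl I" "p = ?p z" unfolding points_over_def by blast
      show "p \<in> ?p ` X \<union> (\<Union>Q\<in>points_over ?J. points_between I ?J Q)"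
      proof (cases "z \<in> cl ?J")
        case True
        then obtain x where x: "x \<in> X" "z \<in> ?p x" using ind(3) z(2) by blast
        then have "?p z = ?p x" using cl_insert_eq[of z x I] z JE by blast
        then show ?thesis using x z(3) by blast
      next
        case False
        then have "cl (insert z ?J) \<in> points_over ?J" using z(1) unfolding points_over_def by blast
        moreover have "p \<in> points_between I ?J (cl (insert z ?J))"
          using p z pin False psub unfolding points_between_def by blast
        ultimately show ?thesis by blast
      qed
    qed
    show "?p ` X \<union> (\<Union>Q\<in>points_over ?J. points_between I ?J Q) \<subseteq> points_over I"
      using xcl unfolding points_over_def points_between_def by blast
  qed
  have fin: "finite (points_between I ?J Q)" for Q
    unfolding points_between_def using finite_points_over by simp
  have "card (points_over I) = card (?p ` X) + card (\<Union>Q\<in>points_over ?J. points_between I ?J Q)"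
    unfolding eq
  proof (rule card_Un_disjoint)
    show "finite (?p ` X)" using indep_finite[OF ind(1)] by simp
    show "finite (\<Union>Q\<in>points_over ?J. points_between I ?J Q)" using fin finite_points_over by blast
    have "?p x \<subseteq> cl ?J" if "x \<in> X" for x using that by (intro cl_mono) blast
    then show "?p ` X \<inter> (\<Union>Q\<in>points_over ?J. points_between I ?J Q) = {}"
      unfolding points_between_def by blast
  qed
  also have "card (?p ` X) = card X" using card_image[OF inj] .
  also have "card (\<Union>Q\<in>points_over ?J. points_between I ?J Q)
      = (\<Sum>Q\<in>points_over ?J. card (points_between I ?J Q))"
  proof (rule card_UN_disjoint)
    show "\<forall>Q\<in>points_over ?J. \<forall>Q'\<in>points_over ?J. Q \<noteq> Q' \<longrightarrow>
        points_between I ?J Q \<inter> points_between I ?J Q' = {}"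
    proof (intro ballI impI)
      fix Q Q' assume Q: "Q \<in> points_over ?J" "Q' \<in> points_over ?J" "Q \<noteq> Q'"
      show "points_between I ?J Q \<inter> points_between I ?J Q' = {}"
      proof (rule ccontr)
        assume "points_between I ?J Q \<inter> points_between I ?J Q' \<noteq> {}"
        then obtain p where p: "p \<in> points_between I ?J Q" "p \<in> points_between I ?J Q'" by blast
        then obtain z where "z \<in> E" "p = ?p z" unfolding points_between_def points_over_def by blast
        then show False using Qeq[OF Q(1)] Qeq[OF Q(2)] p Q(3) by blast
      qed
    qed
  qed (use fin finite_points_over in auto)
  finally show ?thesis .
qed

text \<open>One point comes from the \<open>y\<close> that represents \<open>Q\<close>. As
  \<open>X\<close> cannot be enlarged by \<open>y\<close>, \<open>relative_claw_extend\<close>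
  supplies a \<open>z \<in> Q\<close> outside \<open>cl (insert y I)\<close>, which gives
  another.\<close>

lemma two_le_card_points_between:
  assumes X: "maximal_relative_claw I X" and Q: "Q \<in> points_over (I \<union> X)"
  shows "2 \<le> card (points_between I (I \<union> X) Q)"
proof -
  let ?J = "I \<union> X" and ?p = "\<lambda>x. cl (insert x I)"
  have rc: "relative_claw I X" using X unfolding maximal_relative_claw_def by blast
  then have ind: "indep ?J" unfolding relative_claw_def by blast
  have JE: "?J \<subseteq> E" using indep_subset_E[OF ind] .
  obtain y where y: "y \<in> E" "y \<notin> cl ?J" "Q = cl (insert y ?J)"
    using Q unfolding points_over_def by blast
  have "y \<notin> X" using y subset_cl[OF JE] by blast
  then have "\<not> relative_claw I (insert y X)" using X unfolding maximal_relative_claw_def by blast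
  then obtain z where z: "z \<in> Q" "z \<notin> cl ?J" "z \<notin> ?p y"
    using relative_claw_extend[OF rc y(1,2)] y(3) by blast
  have between: "?p w \<in> points_between I ?J Q" if "w \<in> Q" "w \<notin> cl ?J" for w
  proof -
    have wE: "w \<in> E" using that y(3) cl_subset_E by blast
    moreover have "w \<notin> cl I" using that cl_mono[of I ?J] by blast
    ultimately have "?p w \<in> points_over I" unfolding points_over_def by blast
    moreover have "w \<in> ?p w" using subset_cl[of "insert w I"] wE JE by blast
    moreover have "?p w \<subseteq> Q"
      unfolding y(3) using that y JE subset_cl[of "insert y ?J"] by (intro cl_least) blast
    ultimately show ?thesis using that unfolding points_between_def by blast
  qed
  have "y \<in> Q" using y JE subset_cl[of "insert y ?J"] by blast
  then have "{?p y, ?p z} \<subseteq> points_between I ?J Q" using between y z by blast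
  moreover have "?p y \<noteq> ?p z"
  proof -
    have "z \<in> E" using z(1) y(3) cl_subset_E by blast
    then have "z \<in> ?p z" using subset_cl[of "insert z I"] JE by blast
    then show ?thesis using z(3) by blast
  qed
  moreover have "finite (points_between I ?J Q)"
    unfolding points_between_def using finite_points_over by simp
  ultimately show ?thesis using card_mono[of "points_between I ?J Q" "{?p y, ?p z}"] by simp
qed

lemma card_relative_claw:
  assumes "relative_claw I X" shows "card (I \<union> X) = card I + card X" and "card X \<le> rk E - card I"
proof -
  have "indep (I \<union> X)" "I \<inter> X = {}" using assms unfolding relative_claw_def by auto
  then show *: "card (I \<union> X) = card I + card X"
    using indep_finite[of "I \<union> X"] by (simp add: card_Un_disjoint)
  have "card (I \<union> X) \<le> rk E"
    using \<open>indep (I \<union> X)\<close> indep_card_le_rk indep_subset_E by blast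
  then show "card X \<le> rk E - card I" using * by linarith
qed

lemma relative_claw_card_le:
  assumes "relative_claw I X" "\<not> (\<exists>X. relative_claw I X \<and> card X = t + 1)" shows "card X \<le> t"
proof (rule ccontr)
  assume "\<not> card X \<le> t"
  then obtain Y where "Y \<subseteq> X" "card Y = t + 1"
    using obtain_subset_with_card_n[of "t + 1" X] by auto
  then show False using assms relative_claw_subset by blast
qed

text \<open>Strong induction on the rank of the contraction. The independent set \<open>I\<close> is
  arbitrary because the step passes to \<open>I \<union> X\<close> for a nonempty maximal relative
  claw \<open>X\<close>, counting \<open>card X\<close> points and at least two for each point over
  \<open>I \<union> X\<close>.\<close>

theorem extremal_size_le_card_points_over:
  assumes "indep I" "0 < t" "\<not> (\<exists>X. relative_claw I X \<and> card X = t + 1)"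
  shows "extremal_size (rk E - card I) t \<le> card (points_over I)"
  using assms
proof (induction "rk E - card I" arbitrary: I rule: less_induct)
  case less
  show ?case
  proof (cases "rk E - card I = 0")
    case True
    then show ?thesis by (simp add: extremal_size_def)
  next
    case False
    obtain B where B: "I \<subseteq> B" "basis_of E B"
      using basis_extension[OF less.prems(1) indep_subset_E[OF less.prems(1)]] by blast
    have "card B = rk E" using basis_of_card[OF B(2)] .
    then have "B \<noteq> I" using False by auto
    then obtain x where x: "x \<in> B" "x \<notin> I" using B by blast
    have iB: "indep B" using B unfolding basis_of_def by blast
    then have "x \<in> E" using x indep_subset_E by blast
    moreover have "x \<notin> cl I" using cl_Int_indep[OF iB B(1)] x by blast
    ultimately have "relative_claw I {x}" using relative_claw_singleton less.prems(1) by blast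
    then obtain X where X: "{x} \<subseteq> X" "maximal_relative_claw I X"
      by (rule maximal_relative_claw_exists)
    have rc: "relative_claw I X" using X unfolding maximal_relative_claw_def by blast
    have finX: "finite X" using rc indep_finite unfolding relative_claw_def by blast
    have s: "0 < card X" "card X \<le> t" "card X \<le> rk E - card I"
      using X(1) finX card_gt_0_iff relative_claw_card_le[OF rc less.prems(3)]
        card_relative_claw[OF rc] by auto
    have J: "rk E - card (I \<union> X) = rk E - card I - card X" using card_relative_claw(1)[OF rc] by simp
    have "extremal_size (rk E - card (I \<union> X)) t \<le> card (points_over (I \<union> X))"
    proof (rule less.hyps)
      show "rk E - card (I \<union> X) < rk E - card I" using J s by linarith
      show "indep (I \<union> X)" using rc unfolding relative_claw_def by blast
      show "\<not> (\<exists>Y. relative_claw (I \<union> X) Y \<and> card Y = t + 1)"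
        using relative_claw_antimono less.prems(3) by blast
    qed (use less.prems in auto)
    moreover have "card X + (\<Sum>Q\<in>points_over (I \<union> X). 2) \<le> card (points_over I)"
      unfolding card_points_over_eq[OF rc]
      using two_le_card_points_between[OF X(2)] by (intro add_left_mono sum_mono)
    moreover have "extremal_size (rk E - card I) t
        \<le> card X + 2 * extremal_size (rk E - card I - card X) t"
      using extremal_size_step[OF less.prems(2) s(2,3)] by linarith
    ultimately show ?thesis using J by simp
  qed
qed

text \<open>Equality leaves no slack in the induction step: the surplus \<open>t - card X\<close>,
  the excess of the number of points over \<open>I \<union> X\<close> above its bound, and the
  excesses of the classes above two must all vanish. The second conclusion restores the equality
  hypothesis over \<open>I \<union> X\<close>, so the lemma can be applied again there.\<close>

lemma maximal_relative_claw_extremal: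
  assumes "indep I" "0 < t" "\<not> (\<exists>X. relative_claw I X \<and> card X = t + 1)"
    and "t \<le> rk E - card I" and card: "card (points_over I) = extremal_size (rk E - card I) t"
    and X: "maximal_relative_claw I X"
  shows "card X = t"
    and "card (points_over (I \<union> X)) = extremal_size (rk E - card (I \<union> X)) t"
    and "\<And>Q. Q \<in> points_over (I \<union> X) \<Longrightarrow> card (points_between I (I \<union> X) Q) = 2"
proof -
  let ?P = "points_over (I \<union> X)" and ?c = "\<lambda>Q. card (points_between I (I \<union> X) Q)"
  have rc: "relative_claw I X" using X unfolding maximal_relative_claw_def by blast
  have s: "card X \<le> t" "card X \<le> rk E - card I"
    using relative_claw_card_le[OF rc assms(3)] card_relative_claw[OF rc] by auto
  have J: "rk E - card (I \<union> X) = rk E - card I - card X" using card_relative_claw(1)[OF rc] by simp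
  have low: "extremal_size (rk E - card (I \<union> X)) t \<le> card ?P"
  proof (rule extremal_size_le_card_points_over)
    show "indep (I \<union> X)" using rc unfolding relative_claw_def by blast
    show "\<not> (\<exists>Y. relative_claw (I \<union> X) Y \<and> card Y = t + 1)"
      using relative_claw_antimono assms(3) by blast
  qed (rule assms(2))
  have two: "2 \<le> ?c Q" if "Q \<in> ?P" for Q using two_le_card_points_between[OF X that] .
  have split: "sum ?c ?P = 2 * card ?P + (\<Sum>Q\<in>?P. ?c Q - 2)"
  proof -
    have "sum ?c ?P = (\<Sum>Q\<in>?P. 2 + (?c Q - 2))" using two by (intro sum.cong) force+
    also have "\<dots> = (\<Sum>Q\<in>?P. 2) + (\<Sum>Q\<in>?P. ?c Q - 2)" by (rule sum.distrib)
    finally show ?thesis by simp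
  qed
  have step: "extremal_size (rk E - card I) t + (t - card X)
      \<le> card X + 2 * extremal_size (rk E - card (I \<union> X)) t"
    using extremal_size_step[OF assms(2) s] assms(4) J by simp
  have eq: "extremal_size (rk E - card I) t = card X + (2 * card ?P + (\<Sum>Q\<in>?P. ?c Q - 2))"
    using card_points_over_eq[OF rc] card split by simp
  show "card X = t" using step eq low s by linarith
  show "card ?P = extremal_size (rk E - card (I \<union> X)) t" using step eq low by linarith
  have "(\<Sum>Q\<in>?P. ?c Q - 2) = 0" using step eq low by linarith
  then show "?c Q = 2" if "Q \<in> ?P" for Q
    using two[OF that] that finite_points_over by (force simp: sum_eq_0_iff)
qed

end

section \<open>Binary projective geometries\<close>

locale simple_indep_matroid = indep_matroid +
  assumes simple: "simple_matroid E indep"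
begin

lemma indep_pair: "x \<in> E \<Longrightarrow> y \<in> E \<Longrightarrow> indep {x, y}"
  using simple unfolding simple_matroid_def by blast

lemma cl_empty: "cl {} = {}"
proof -
  \<comment> \<open>The case \<open>x = y\<close> of simplicity rules out loops.\<close>
  have "indep {x}" if "x \<in> E" for x using indep_pair[OF that that] by simp
  then show ?thesis using cl_indep[OF indep_empty] by blast
qed

lemma cl_singleton: assumes "x \<in> E" shows "cl {x} = {x}"
proof -
  have "indep {x}" using indep_pair[OF assms assms] by simp
  moreover have "indep {y, x}" if "y \<in> E" for y using indep_pair[OF that assms] .
  ultimately show ?thesis using cl_indep[of "{x}"] assms by blast
qed

lemma claw_iff: "claw E indep X \<longleftrightarrow> indep X \<and> cl X \<subseteq> X"
  unfolding claw_def flat_def using subset_cl indep_subset_E by blast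

lemma relative_claw_empty_iff: "relative_claw {} X \<longleftrightarrow> claw E indep X"
proof -
  have "(\<Union>x\<in>X. cl {x}) = X" if "indep X"
    using indep_subset_E[OF that] cl_singleton by auto
  then show ?thesis unfolding relative_claw_def claw_iff by (auto simp: cl_empty)
qed

lemma points_over_empty: "points_over {} = (\<lambda>x. {x}) ` E"
  unfolding points_over_def cl_empty using cl_singleton by auto

lemma card_points_over_empty: "card (points_over {}) = card E"
  by (simp add: points_over_empty card_image)

section \<open>Three-point lines and projective sets\<close>

definition line :: "'a \<Rightarrow> 'a \<Rightarrow> 'a \<Rightarrow> bool" where
  "line x y z \<longleftrightarrow> x \<in> E \<and> y \<in> E \<and> x \<noteq> y \<and> z \<noteq> x \<and> z \<noteq> y \<and> cl {x, y} = {x, y, z}"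

lemma line_swap: "line x y z \<Longrightarrow> line y x z"
  unfolding line_def by (auto simp: insert_commute)

lemma line_rot: assumes "line x y z" shows "line x z y"
proof -
  have l: "x \<in> E" "y \<in> E" "x \<noteq> y" "z \<noteq> x" "z \<noteq> y" "cl {x, y} = {x, y, z}"
    using assms unfolding line_def by auto
  have "z \<in> E" using l cl_subset_E by blast
  moreover have "cl {z, x} = cl {y, x}"
    by (rule cl_insert_eq) (use l cl_singleton in \<open>auto simp: insert_commute\<close>)
  ultimately show ?thesis using l unfolding line_def by (auto simp: insert_commute)
qed

lemma line_unique: "line x y z \<Longrightarrow> line x y w \<Longrightarrow> z = w"
  unfolding line_def by blast

lemma line_in_cl: assumes "line x y z" "x \<in> cl A" "y \<in> cl A" shows "z \<in> cl A"
  using assms cl_least[of "{x, y}" A] unfolding line_def by blast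

text \<open>This property alone does not make \<open>C\<close> binary: the affine plane of order
  three has it, with nine points in rank three. Binarity follows once the size is the least
  possible, \<open>2 ^ rk C - 1\<close>.\<close>

definition projective :: "'a set \<Rightarrow> bool" where
  "projective C \<longleftrightarrow> C \<subseteq> E \<and> (\<forall>x\<in>C. \<forall>y\<in>C. x \<noteq> y \<longrightarrow> (\<exists>z\<in>C. line x y z))"

text \<open>\<open>h\<close> sends \<open>a\<close> to the third point of the line through
  \<open>e\<close> and \<open>a\<close>. It is injective since \<open>e\<close> and
  \<open>h a\<close> determine \<open>a\<close>, and \<open>h a\<close> lies outside
  \<open>cl D\<close> since otherwise \<open>e\<close> would lie in \<open>cl D\<close> as
  well.\<close>

lemma projective_reflection:
  assumes "projective C" "e \<in> C" "e \<notin> cl D"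
  obtains h where "inj_on h (cl D \<inter> C)" "h ` (cl D \<inter> C) \<subseteq> C - cl D - {e}"
    "\<And>a. a \<in> cl D \<inter> C \<Longrightarrow> line e a (h a)"
proof -
  have "\<forall>a\<in>cl D \<inter> C. \<exists>z. z \<in> C \<and> line e a z"
    using assms unfolding projective_def by (metis IntE)
  then obtain h where h: "\<And>a. a \<in> cl D \<inter> C \<Longrightarrow> h a \<in> C" "\<And>a. a \<in> cl D \<inter> C \<Longrightarrow> line e a (h a)"
    using bchoice[of "cl D \<inter> C" "\<lambda>a z. z \<in> C \<and> line e a z"] by blast
  have "inj_on h (cl D \<inter> C)"
    using h(2) line_rot line_unique by (metis inj_onI)
  moreover have "h a \<in> C - cl D - {e}" if a: "a \<in> cl D \<inter> C" for a
  proof -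
    have "h a \<notin> cl D"
      using line_in_cl[of a "h a" e D] line_rot[OF line_swap[OF h(2)[OF a]]] a assms(3) by blast
    moreover have "h a \<noteq> e" using h(2)[OF a] unfolding line_def by blast
    ultimately show ?thesis using h(1)[OF a] by blast
  qed
  ultimately show ?thesis using that[of h] h(2) by blast
qed

text \<open>Adding \<open>e\<close> to \<open>B\<close> brings in \<open>e\<close> and a reflected
  copy of \<open>cl B \<inter> C\<close>, so the size at least doubles and grows by one
  more.\<close>

lemma projective_card_ge:
  assumes "projective C" "indep B" "B \<subseteq> C"
  shows "2 ^ card B - 1 \<le> card (cl B \<inter> C)"
proof -
  have "finite B" using assms(2) indep_finite by blast
  then show ?thesis using assms(2,3)
  proof (induction B)
    case (insert e B)
    have B: "indep B" using insert.prems(1) indep_mono by blast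
    have e: "e \<in> C" "e \<notin> cl B" using insert indep_notin_cl by blast+
    obtain h where h: "inj_on h (cl B \<inter> C)" "h ` (cl B \<inter> C) \<subseteq> C - cl B - {e}"
      "\<And>a. a \<in> cl B \<inter> C \<Longrightarrow> line e a (h a)"
      using projective_reflection[OF assms(1) e] by blast
    let ?A = "cl B \<inter> C"
    have fin: "finite ?A" using finite_cl by blast
    have eE: "insert e B \<subseteq> E" using insert.prems(1) indep_subset_E by blast
    have Acl: "?A \<subseteq> cl (insert e B)" using cl_mono[of B "insert e B"] by blast
    have ecl: "e \<in> cl (insert e B)" using subset_cl[OF eE] by blast
    have "h ` ?A \<subseteq> cl (insert e B)"
      using h(3) line_in_cl[OF _ ecl] Acl by blast
    then have "insert e (?A \<union> h ` ?A) \<subseteq> cl (insert e B) \<inter> C"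
      using h(2) Acl ecl e by blast
    moreover have "card (insert e (?A \<union> h ` ?A)) = Suc (2 * card ?A)"
    proof -
      have "card (?A \<union> h ` ?A) = card ?A + card (h ` ?A)"
        using fin h(2) by (intro card_Un_disjoint) auto
      moreover have "e \<notin> ?A \<union> h ` ?A" using e h(2) by blast
      ultimately show ?thesis using fin card_image[OF h(1)] by simp
    qed
    ultimately have "Suc (2 * card ?A) \<le> card (cl (insert e B) \<inter> C)"
      using card_mono[of "cl (insert e B) \<inter> C"] finite_cl by (metis finite_Int)
    moreover have "2 ^ card B - 1 \<le> card ?A" using insert B by blast
    ultimately show ?case using insert.hyps by simp
  qed simp
qed

text \<open>By minimality of the size, the reflection through a point \<open>x\<close> off the
  hyperplane reaches every other such point \<open>y\<close>, so the third point of their line is in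
  the hyperplane. Thus each line has an even number of points off each hyperplane, which is
  linearity over the two-element field.\<close>

lemma projective_hyperplane_line:
  assumes C: "projective C" "basis_of C B" "card C = 2 ^ card B - 1"
    and b: "b \<in> B" and l: "line x y z" "x \<in> C" "y \<in> C" "z \<in> C"
  shows "z \<in> cl (B - {b}) \<longleftrightarrow> (x \<in> cl (B - {b}) \<longleftrightarrow> y \<in> cl (B - {b}))"
proof -
  let ?D = "B - {b}"
  let ?H = "cl ?D \<inter> C"
  have B: "B \<subseteq> C" "indep B" using C(2) unfolding basis_of_def by auto
  have finC: "finite C" using C(1) finite_E finite_subset unfolding projective_def by blast
  have both: "z \<in> cl ?D" if x: "x \<notin> cl ?D" and y: "y \<notin> cl ?D"
  proof -
    obtain h where h: "inj_on h ?H" "h ` ?H \<subseteq> C - cl ?D - {x}" "\<And>a. a \<in> ?H \<Longrightarrow> line x a (h a)"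
      using projective_reflection[OF C(1) l(2) x] by blast
    have "2 ^ card ?D - 1 \<le> card ?H"
      using projective_card_ge[OF C(1), of ?D] B indep_mono by blast
    moreover have "card B = Suc (card ?D)"
      using b indep_finite[OF B(2)] by (metis card.remove)
    moreover have "card (C - cl ?D - {x}) = card C - card ?H - 1"
    proof -
      have "C - cl ?D - {x} = C - insert x ?H" by blast
      moreover have "card (insert x ?H) = Suc (card ?H)" using x finC by simp
      moreover have "insert x ?H \<subseteq> C" using l by blast
      ultimately show ?thesis using finC by (simp add: card_Diff_subset finite_subset)
    qed
    ultimately have "card (C - cl ?D - {x}) \<le> card (h ` ?H)"
      using C(3) card_image[OF h(1)] by simp
    then have "h ` ?H = C - cl ?D - {x}" using card_seteq[OF _ h(2)] finC by blast
    moreover have "y \<in> C - cl ?D - {x}" using l y unfolding line_def by blast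
    ultimately obtain a where a: "a \<in> ?H" "y = h a" by blast
    then have "a = z" using h(3)[OF a(1)] line_rot line_unique l(1) by blast
    then show ?thesis using a by blast
  qed
  have "line x z y" "line y z x" using l(1) line_rot line_swap by blast+
  then have "x \<in> cl ?D \<Longrightarrow> z \<in> cl ?D \<Longrightarrow> y \<in> cl ?D" "y \<in> cl ?D \<Longrightarrow> z \<in> cl ?D \<Longrightarrow> x \<in> cl ?D"
    "x \<in> cl ?D \<Longrightarrow> y \<in> cl ?D \<Longrightarrow> z \<in> cl ?D"
    using line_in_cl l(1) by blast+
  then show ?thesis using both by argo
qed

text \<open>Points and their sums over the two-element field are handled through their pairings with
  hyperplanes: modulo hyperplanes, every set of points is equivalent to zero or to a single point.\<close>

lemma projective_set_sum:
  assumes C: "projective C" "card C = 2 ^ rk C - 1" and T: "T \<subseteq> C"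
  shows "(\<forall>B b. basis_of C B \<longrightarrow> b \<in> B \<longrightarrow> even (card (T - cl (B - {b})))) \<or>
    (\<exists>p\<in>C. \<forall>B b. basis_of C B \<longrightarrow> b \<in> B \<longrightarrow> (odd (card (T - cl (B - {b}))) \<longleftrightarrow> p \<notin> cl (B - {b})))"
    (is "?null T \<or> (\<exists>p\<in>C. ?sum T p)")
proof -
  have "C \<subseteq> E" using C(1) unfolding projective_def by blast
  then have "finite T" using T finite_E finite_subset by metis
  then show ?thesis using T
  proof (induction T)
    case (insert x T)
    have x: "x \<in> C" "x \<notin> T" using insert by auto
    have odd_insert: "odd (card (insert x T - A)) \<longleftrightarrow> (x \<in> A \<longleftrightarrow> odd (card (T - A)))" for A
      using insert.hyps by (cases "x \<in> A") (auto simp: insert_Diff_if)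
    have "T \<subseteq> C" using insert.prems by blast
    then consider "?null T" | p where "p \<in> C" "?sum T p" using insert.IH by blast
    then show ?case
    proof cases
      case 1
      then have "?sum (insert x T) x" using odd_insert by blast
      then show ?thesis using x by blast
    next
      case 2
      show ?thesis
      \<comment> \<open>Two equal points cancel; two distinct ones add up to the third point of
        their line.\<close>
      proof (cases "p = x")
        case True
        then have "?null (insert x T)" using 2 odd_insert by blast
        then show ?thesis by blast
      next
        case False
        then obtain z where z: "z \<in> C" "line p x z" using C(1) x 2 unfolding projective_def by blast
        have "z \<in> cl (B - {b}) \<longleftrightarrow> (p \<in> cl (B - {b}) \<longleftrightarrow> x \<in> cl (B - {b}))"
          if "basis_of C B" "b \<in> B" for B b
          using projective_hyperplane_line[OF C(1) that(1) _ that(2) z(2)] 2 x z C(2)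
            basis_of_card[OF that(1)] by simp
        then have "?sum (insert x T) z" using 2 odd_insert by blast
        then show ?thesis using z by blast
      qed
    qed
  qed simp
qed

section \<open>Coordinates and independence over the two-element field\<close>

lemma point_off_hyperplane:
  assumes "basis_of C B" "C \<subseteq> E" "p \<in> C" shows "\<exists>b\<in>B. p \<notin> cl (B - {b})"
proof (rule ccontr)
  assume "\<not> ?thesis"
  then have "supp B p = {}" unfolding supp_def by blast
  moreover have "p \<in> cl B" using cl_basis[OF assms(1)] subset_cl[OF assms(2)] assms(3) by blast
  ultimately have "p \<in> cl {}"
    using in_cl_iff_supp[of B p "{}"] assms(1) unfolding basis_of_def by blast
  then show False using cl_empty by blast
qed

text \<open>If \<open>X\<close> is independent, a basis of \<open>C\<close> through \<open>X\<close>
  has for each \<open>e \<in> T\<close> a hyperplane missing only \<open>e\<close> from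
  \<open>T\<close>; this is why all bases are quantified over. If \<open>X\<close> is dependent, a
  circuit in it is even on the hyperplanes of one basis, so it represents no point and must be
  null.\<close>

lemma indep_iff_no_null_subset:
  assumes C: "projective C" "card C = 2 ^ rk C - 1" and X: "X \<subseteq> C"
  shows "indep X \<longleftrightarrow> (\<forall>T\<subseteq>X. T \<noteq> {} \<longrightarrow>
    \<not> (\<forall>B b. basis_of C B \<longrightarrow> b \<in> B \<longrightarrow> even (card (T - cl (B - {b})))))"
    (is "_ \<longleftrightarrow> (\<forall>T\<subseteq>X. T \<noteq> {} \<longrightarrow> \<not> ?null T)")
proof
  assume iX: "indep X"
  show "\<forall>T\<subseteq>X. T \<noteq> {} \<longrightarrow> \<not> ?null T"
  proof (intro allI impI notI)
    fix T assume T: "T \<subseteq> X" "T \<noteq> {}" "?null T"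
    obtain e where e: "e \<in> T" using T by blast
    obtain B where B: "X \<subseteq> B" "basis_of C B" using basis_extension[OF iX X] by blast
    have "cl (B - {e}) \<inter> B = B - {e}"
      using cl_Int_indep[of B "B - {e}"] B(2) unfolding basis_of_def by blast
    then have "T - cl (B - {e}) = {e}" using T(1) B(1) e by blast
    moreover have "even (card (T - cl (B - {e})))" using T e B by blast
    ultimately show False by simp
  qed
next
  assume nn: "\<forall>T\<subseteq>X. T \<noteq> {} \<longrightarrow> \<not> ?null T"
  show "indep X"
  proof (rule ccontr)
    assume dep: "\<not> indep X"
    have CE: "C \<subseteq> E" using C(1) unfolding projective_def by blast
    obtain A where A: "basis_of X A" by (rule basis_exists)
    have iA: "indep A" "A \<subseteq> X" using A unfolding basis_of_def by auto
    have "A \<noteq> X" using iA(1) dep by auto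
    then obtain x where x: "x \<in> X" "x \<notin> A" using iA(2) by blast
    have "X \<subseteq> cl A" using cl_basis[OF A] subset_cl[of X] X CE by (metis subset_trans)
    then have xA: "x \<in> cl A" using x(1) by blast
    obtain B where B: "A \<subseteq> B" "basis_of C B" using basis_extension[OF iA(1) subset_trans[OF iA(2) X]] by blast
    have iB: "indep B" using B unfolding basis_of_def by blast
    have xB: "x \<in> cl B" using xA cl_mono[OF B(1)] by blast
    \<comment> \<open>This is the fundamental circuit of \<open>x\<close>: off
      \<open>cl (B - {b})\<close> lie both \<open>x\<close> and \<open>b\<close>, or no member of
      it.\<close>
    let ?T = "insert x (supp B x)"
    have sA: "supp B x \<subseteq> A" using in_cl_iff_supp[OF iB xB B(1)] xA by blast
    have TX: "?T \<subseteq> X" using sA iA x by blast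
    have ev: "even (card (?T - cl (B - {b})))" if b: "b \<in> B" for b
    proof (cases "b \<in> supp B x")
      case True
      have eq: "cl (B - {b}) \<inter> B = B - {b}" using cl_Int_indep[OF iB] by blast
      have "x \<notin> cl (B - {b})" using True unfolding supp_def by blast
      then have "?T - cl (B - {b}) = {x, b}" using eq True sA B(1) by blast
      moreover have "x \<noteq> b" using True sA x by blast
      ultimately show ?thesis by simp
    next
      case False
      then have "x \<in> cl (B - {b})" using b unfolding supp_def by blast
      moreover have "supp B x \<subseteq> cl (B - {b})"
        using False subset_cl[of "B - {b}"] indep_subset_E[OF iB] sA B(1) by blast
      ultimately have "?T - cl (B - {b}) = {}" by blast
      then show ?thesis by (metis card.empty even_zero)
    qed
    have "\<not> ?null ?T" using nn[rule_format, OF TX] by blast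
    then obtain p where p: "p \<in> C"
      "\<And>B b. basis_of C B \<Longrightarrow> b \<in> B \<Longrightarrow> odd (card (?T - cl (B - {b}))) \<longleftrightarrow> p \<notin> cl (B - {b})"
      using projective_set_sum[OF C, of ?T] TX X by (meson subset_trans)
    then show False using point_off_hyperplane[OF B(2) CE p(1)] ev B(2) by blast
  qed
qed

text \<open>The vector \<open>\<phi> x\<close> is the support of \<open>x\<close> in a fixed basis.
  If distinct points had the same vector, their third point would lie on all coordinate hyperplanes;
  surjectivity then follows by counting.\<close>

theorem projective_iso_PG:
  assumes C: "projective C" "card C = 2 ^ rk C - 1"
  obtains \<phi> where "bij_betw \<phi> C (PG_ground (rk C))"
    "\<And>X. X \<subseteq> C \<Longrightarrow> indep X \<longleftrightarrow> gf2_indep (\<phi> ` X)"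
proof -
  have CE: "C \<subseteq> E" using C(1) unfolding projective_def by blast
  have finC: "finite C" using CE finite_E finite_subset by blast
  obtain B where B: "basis_of C B" by (rule basis_exists)
  define n where "n = rk C"
  have "finite B" "card B = n"
    using B indep_finite basis_of_card[OF B] unfolding basis_of_def n_def by auto
  then obtain b where b: "bij_betw b {..<n} B"
    using ex_bij_betw_nat_finite[of B] by (auto simp: lessThan_atLeast0)
  define \<phi> where "\<phi> x = {j. j < n \<and> x \<notin> cl (B - {b j})}" for x
  have bB: "b j \<in> B" if "j < n" for j using b that unfolding bij_betw_def by blast
  have off: "\<exists>j<n. p \<notin> cl (B - {b j})" if "p \<in> C" for p
    using point_off_hyperplane[OF B CE that] b unfolding bij_betw_def by blast
  have inj: "inj_on \<phi> C"
  proof (rule inj_onI, rule ccontr)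
    fix x y assume xy: "x \<in> C" "y \<in> C" "\<phi> x = \<phi> y" "x \<noteq> y"
    then obtain z where z: "z \<in> C" "line x y z" using C(1) unfolding projective_def by blast
    obtain j where j: "j < n" "z \<notin> cl (B - {b j})" using off[OF z(1)] by blast
    have "j \<in> \<phi> x \<longleftrightarrow> j \<in> \<phi> y" using xy by blast
    then have "x \<in> cl (B - {b j}) \<longleftrightarrow> y \<in> cl (B - {b j})" using j unfolding \<phi>_def by blast
    then show False
      using projective_hyperplane_line[OF C(1) B _ bB[OF j(1)] z(2)] xy z j C(2) basis_of_card[OF B]
      by simp
  qed
  have sub: "\<phi> ` C \<subseteq> PG_ground n" using off unfolding \<phi>_def PG_ground_def by blast
  have "card (\<phi> ` C) = card (PG_ground n)"
    using card_image[OF inj] C(2) by (simp add: card_PG_ground n_def)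
  then have bij: "bij_betw \<phi> C (PG_ground n)"
    using card_subset_eq[OF finite_PG_ground sub] inj unfolding bij_betw_def by blast
  have sum: "gf2_sum (\<phi> ` T) = {j. j < n \<and> odd (card (T - cl (B - {b j})))}" if T: "T \<subseteq> C" for T
  proof -
    have "card {v \<in> \<phi> ` T. j \<in> v} = (if j < n then card (T - cl (B - {b j})) else 0)" for j
    proof -
      have "{v \<in> \<phi> ` T. j \<in> v} = \<phi> ` {x \<in> T. j \<in> \<phi> x}" by blast
      moreover have "inj_on \<phi> {x \<in> T. j \<in> \<phi> x}" by (rule inj_on_subset[OF inj]) (use T in blast)
      moreover have "{x \<in> T. j \<in> \<phi> x} = (if j < n then T - cl (B - {b j}) else {})"
        unfolding \<phi>_def by auto
      ultimately show ?thesis by (simp add: card_image)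
    qed
    then show ?thesis unfolding gf2_sum_def by auto
  qed
  \<comment> \<open>The coordinates see only the hyperplanes of the chosen basis. A set even on
    these is even on all, since otherwise it would represent a point, and each point is off one of
    them.\<close>
  have null: "gf2_sum (\<phi> ` T) = {} \<longleftrightarrow>
    (\<forall>B b. basis_of C B \<longrightarrow> b \<in> B \<longrightarrow> even (card (T - cl (B - {b}))))" (is "_ \<longleftrightarrow> ?null T")
    if T: "T \<subseteq> C" for T
  proof
    assume "?null T"
    then show "gf2_sum (\<phi> ` T) = {}" using sum[OF T] B bB by blast
  next
    assume s: "gf2_sum (\<phi> ` T) = {}"
    show "?null T"
    proof (rule ccontr)
      assume "\<not> ?null T"
      then obtain p where p: "p \<in> C"
        "\<And>B b. basis_of C B \<Longrightarrow> b \<in> B \<Longrightarrow> odd (card (T - cl (B - {b}))) \<longleftrightarrow> p \<notin> cl (B - {b})"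
        using projective_set_sum[OF C T] by meson
      then show False using off[OF p(1)] s B bB unfolding sum[OF T] by blast
    qed
  qed
  have "indep X \<longleftrightarrow> gf2_indep (\<phi> ` X)" if X: "X \<subseteq> C" for X
  proof -
    have "gf2_indep (\<phi> ` X) \<longleftrightarrow> (\<forall>T\<subseteq>X. T \<noteq> {} \<longrightarrow> gf2_sum (\<phi> ` T) \<noteq> {})"
      unfolding gf2_indep_def by (auto simp: all_subset_image)
    also have "\<dots> \<longleftrightarrow> indep X"
      unfolding indep_iff_no_null_subset[OF C X] using null X by (meson subset_trans)
    finally show ?thesis by blast
  qed
  then show ?thesis using that[of \<phi>] bij unfolding n_def by blast
qed

theorem card_ge_extremal_size:
  assumes "0 < t" "\<not> (\<exists>S. claw E indep S \<and> card S = t + 1)"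
  shows "extremal_size (rk E) t \<le> card E"
  using extremal_size_le_card_points_over[OF indep_empty assms(1)] assms(2)
  by (simp add: relative_claw_empty_iff card_points_over_empty)

end

section \<open>The extremal case\<close>

text \<open>The rank bound leaves room for the equality analysis twice in succession: over the empty
  set, and then over a \<open>t\<close>-claw.\<close>

locale extremal_matroid = simple_indep_matroid +
  fixes t :: nat
  assumes t_pos: "0 < t"
    and no_claw: "\<not> (\<exists>S. claw E indep S \<and> card S = t + 1)"
    and rank_ge: "2 * t \<le> rk E"
    and card_E: "card E = extremal_size (rk E) t"
begin

lemma claw_extends:
  assumes "claw E indep Y" obtains S where "Y \<subseteq> S" "claw E indep S" "card S = t"
proof -
  have "relative_claw {} Y" using assms relative_claw_empty_iff by blast
  then obtain S where S: "Y \<subseteq> S" "maximal_relative_claw {} S" by (rule maximal_relative_claw_exists)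
  then have "claw E indep S" unfolding maximal_relative_claw_def relative_claw_empty_iff by blast
  moreover have "card S = t"
    by (rule maximal_relative_claw_extremal(1)[OF indep_empty t_pos _ _ _ S(2)])
      (use no_claw rank_ge card_E in \<open>simp_all add: relative_claw_empty_iff card_points_over_empty\<close>)
  ultimately show ?thesis using that S by blast
qed

section \<open>Three-point lines between a \<open>t\<close>-claw and the other elements\<close>

context
  fixes S assumes S: "claw E indep S" and card_S: "card S = t"
begin

lemma maximal_S: "maximal_relative_claw {} S"
proof -
  have "finite S" using S indep_finite unfolding claw_def by blast
  then have "card (insert y S) = t + 1" if "y \<notin> S" for y using that card_S by simp
  then show ?thesis
    unfolding maximal_relative_claw_def relative_claw_empty_iff using S no_claw by blast
qed

lemma indep_S: "indep S" and S_subset_E: "S \<subseteq> E" and cl_S: "cl S = S"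
  using S unfolding claw_def flat_def by auto

lemma card_points_over_S: "card (points_over S) = extremal_size (rk E - card S) t"
  using maximal_relative_claw_extremal(2)[OF indep_empty t_pos _ _ _ maximal_S]
    no_claw rank_ge card_E by (simp add: relative_claw_empty_iff card_points_over_empty)

text \<open>Over the empty set the points are singletons, so equality in the count says that the
  parallel class of \<open>x\<close> modulo \<open>S\<close> has exactly two elements.\<close>

lemma two_points_over_S:
  assumes x: "x \<in> E - S"
  obtains x' where "x' \<noteq> x" "x' \<notin> S" "cl (insert x S) = {x, x'} \<union> S"
proof -
  let ?Q = "cl (insert x S)"
  have Q: "?Q \<in> points_over S" using x cl_S unfolding points_over_def by blast
  have "card (points_between {} ({} \<union> S) ?Q) = 2"
    using maximal_relative_claw_extremal(3)[OF indep_empty t_pos _ _ _ maximal_S, of ?Q]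
      no_claw rank_ge card_E Q by (simp add: relative_claw_empty_iff card_points_over_empty)
  moreover have "points_between {} S ?Q = (\<lambda>z. {z}) ` (?Q - S)"
    unfolding points_between_def points_over_empty cl_S using cl_subset_E[of "insert x S"] by auto
  ultimately have "card (?Q - S) = 2" by (simp add: card_image)
  moreover have sub: "insert x S \<subseteq> ?Q" using x S_subset_E by (intro subset_cl) blast
  ultimately obtain a b where ab: "a \<noteq> b" "?Q - S = {a, b}" by (auto simp: card_2_iff)
  have "x \<in> {a, b}" using ab x sub by blast
  then have "\<exists>x'. x' \<noteq> x \<and> ?Q - S = {x, x'}" using ab by (metis insert_commute insertE singletonD)
  then obtain x' where x': "x' \<noteq> x" "?Q - S = {x, x'}" by blast
  moreover have "?Q = {x, x'} \<union> S" using x'(2) sub by blast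
  ultimately show ?thesis using that by blast
qed

text \<open>With \<open>Z\<close> chosen through \<open>x\<close>, counting makes \<open>T x\<close>
  a singleton \<open>{s}\<close>. So the partner \<open>p x\<close> lies on the line from
  \<open>x\<close> to \<open>s\<close> and on no line from \<open>x\<close> to another member of
  \<open>S\<close>.\<close>

lemma unique_line_to_S:
  assumes x: "x \<in> E - S"
  obtains s x' where "s \<in> S" "line s x x'" "\<And>s'. s' \<in> S \<Longrightarrow> s' \<noteq> s \<Longrightarrow> cl {s', x} = {s', x}"
proof -
  have "relative_claw S {x}" using relative_claw_singleton indep_S x cl_S by blast
  then obtain Z where Z: "{x} \<subseteq> Z" "maximal_relative_claw S Z" by (rule maximal_relative_claw_exists)
  have card_Z: "card Z = t"
  proof (rule maximal_relative_claw_extremal(1)[OF indep_S t_pos _ _ card_points_over_S Z(2)])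
    show "\<not> (\<exists>X. relative_claw S X \<and> card X = t + 1)"
      using no_claw relative_claw_antimono[of S _ "{}"] relative_claw_empty_iff by blast
    show "t \<le> rk E - card S" using rank_ge card_S by simp
  qed
  let ?B = "S \<union> Z"
  have B: "indep ?B" "S \<inter> Z = {}" "cl ?B \<subseteq> S \<union> (\<Union>z\<in>Z. cl (insert z S))"
    using Z(2) cl_S unfolding maximal_relative_claw_def relative_claw_def by auto
  have BE: "?B \<subseteq> E" using indep_subset_E[OF B(1)] .
  have finZ: "finite Z" and finS: "finite S" using indep_finite[OF B(1)] by auto
  have "\<forall>z\<in>Z. \<exists>p. p \<noteq> z \<and> p \<notin> S \<and> cl (insert z S) = {z, p} \<union> S"
  proof
    fix z assume "z \<in> Z"
    then have "z \<in> E - S" using B(2) BE by blast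
    then show "\<exists>p. p \<noteq> z \<and> p \<notin> S \<and> cl (insert z S) = {z, p} \<union> S"
      using two_points_over_S[of z] by metis
  qed
  then obtain p where p: "\<And>z. z \<in> Z \<Longrightarrow> p z \<noteq> z" "\<And>z. z \<in> Z \<Longrightarrow> p z \<notin> S"
    "\<And>z. z \<in> Z \<Longrightarrow> cl (insert z S) = {z, p z} \<union> S"
    by metis
  have pB: "p z \<in> cl ?B" if "z \<in> Z" for z
  proof -
    have "p z \<in> cl (insert z S)" using p(3)[OF that] by blast
    moreover have "cl (insert z S) \<subseteq> cl ?B" using that by (intro cl_mono) blast
    ultimately show ?thesis by blast
  qed
  have p_iff: "p z \<in> cl A \<longleftrightarrow> supp ?B (p z) \<subseteq> A" if "z \<in> Z" "A \<subseteq> ?B" for z A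
    using in_cl_iff_supp[OF B(1) pB[OF that(1)] that(2)] .
  have supp_sub: "supp ?B (p z) \<subseteq> insert z S" if "z \<in> Z" for z
    using p_iff[OF that, of "insert z S"] p(3)[OF that] that by blast
  define T where "T z = supp ?B (p z) \<inter> S" for z
  \<comment> \<open>Otherwise the partner would be parallel to \<open>z\<close>, against
    simplicity.\<close>
  have T_ne: "T z \<noteq> {}" if z: "z \<in> Z" for z
  proof
    assume "T z = {}"
    then have "supp ?B (p z) \<subseteq> {z}" using supp_sub[OF z] unfolding T_def by blast
    then have "p z \<in> cl {z}" using p_iff[OF z, of "{z}"] z by blast
    moreover have "z \<in> E" using z BE by blast
    ultimately show False using p(1)[OF z] cl_singleton by blast
  qed
  have T_disj: "T z \<inter> T w = {}" if zw: "z \<in> Z" "w \<in> Z" "z \<noteq> w" for z w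
  proof (rule ccontr)
    assume "T z \<inter> T w \<noteq> {}"
    then obtain s where s: "s \<in> S" "s \<in> supp ?B (p z)" "s \<in> supp ?B (p w)" unfolding T_def by blast
    \<comment> \<open>This would be a claw with \<open>t + 1\<close> elements: spanning
      \<open>p z\<close> or \<open>p w\<close> needs the removed \<open>s\<close>, and for any other
      \<open>v \<in> Z\<close> spanning \<open>p v\<close> needs \<open>v\<close>, which is not in
      \<open>A\<close>.\<close>
    define A where "A = {z, w} \<union> (S - {s})"
    have A: "A \<subseteq> ?B" "s \<notin> A" using zw s B(2) unfolding A_def by auto
    have "cl A \<subseteq> A"
    proof
      fix y assume y: "y \<in> cl A"
      have AB: "cl A \<inter> ?B = A" using cl_Int_indep[OF B(1) A(1)] .
      have "y \<in> cl ?B" using y cl_mono[OF A(1)] by blast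
      then have "y \<in> S \<or> (\<exists>v\<in>Z. y \<in> {v, p v} \<union> S)" using B(3) p(3) by auto
      then consider "y \<in> ?B" | v where "v \<in> Z" "y = p v" by blast
      then show "y \<in> A"
      proof cases
        case 1
        then show ?thesis using y AB by blast
      next
        case 2
        then have sA: "supp ?B (p v) \<subseteq> A" using p_iff[OF 2(1) A(1)] y by blast
        show ?thesis
        proof (cases "v = z \<or> v = w")
          case True
          then show ?thesis using sA s A(2) by blast
        next
          case False
          then have "v \<notin> A" using 2(1) B(2) unfolding A_def by blast
          then have "supp ?B (p v) \<subseteq> S" using sA supp_sub[OF 2(1)] by blast
          then have "p v \<in> cl S" using p_iff[OF 2(1), of S] by blast
          then show ?thesis using cl_S p(2)[OF 2(1)] by blast
        qed
      qed
    qed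
    then have "claw E indep A" using claw_iff indep_mono[OF B(1) A(1)] by blast
    moreover have "card A = t + 1"
    proof -
      have "card A = card {z, w} + card (S - {s})"
        unfolding A_def using zw B(2) finS by (intro card_Un_disjoint) auto
      moreover have "card (S - {s}) = t - 1" using s(1) card_S finS by simp
      ultimately show ?thesis using zw(3) t_pos by simp
    qed
    ultimately show False using no_claw by blast
  qed
  have finT: "finite (T z)" for z unfolding T_def using finS by blast
  \<comment> \<open>These are \<open>t\<close> disjoint nonempty subsets of a set with
    \<open>t\<close> elements, so none of them can have two elements.\<close>
  have "(\<Sum>z\<in>Z. card (T z)) = card (\<Union>z\<in>Z. T z)"
    by (rule card_UN_disjoint[symmetric]) (use finZ finT T_disj in auto)
  also have "\<dots> \<le> card S" by (rule card_mono[OF finS]) (auto simp: T_def)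
  also have "\<dots> = (\<Sum>z\<in>Z. 1)" using card_S card_Z by simp
  finally have le: "(\<Sum>z\<in>Z. card (T z)) \<le> (\<Sum>z\<in>Z. 1)" .
  have xZ: "x \<in> Z" using Z by blast
  have "card (T x) = 1"
  proof (rule ccontr)
    assume "card (T x) \<noteq> 1"
    moreover have ge1: "1 \<le> card (T z)" if "z \<in> Z" for z
      using T_ne[OF that] finT by (simp add: Suc_le_eq card_gt_0_iff)
    ultimately have "1 < card (T x)" using xZ by fastforce
    then have "(\<Sum>z\<in>Z. 1) < (\<Sum>z\<in>Z. card (T z))"
      using ge1 xZ by (intro sum_strict_mono_ex1[OF finZ]) auto
    then show False using le by linarith
  qed
  then obtain s where s: "T x = {s}" by (auto simp: card_1_singleton_iff)
  have sS: "s \<in> S" using s unfolding T_def by blast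
  have supp: "supp ?B (p x) \<subseteq> {s, x}" "s \<in> supp ?B (p x)"
    using s supp_sub[OF xZ] unfolding T_def by auto
  have cl_line: "cl {s', x} \<subseteq> {s', x, p x}" if s': "s' \<in> S" for s'
  proof
    fix y assume y: "y \<in> cl {s', x}"
    have "cl {s', x} \<subseteq> cl (insert x S)" using s' by (intro cl_mono) blast
    then have "y \<in> {x, p x} \<or> y \<in> S" using y p(3)[OF xZ] by blast
    moreover have "cl {s', x} \<inter> ?B = {s', x}" using cl_Int_indep[OF B(1), of "{s', x}"] s' xZ by blast
    ultimately show "y \<in> {s', x, p x}" using y by blast
  qed
  have sub_line: "{s', x} \<subseteq> cl {s', x}" if "s' \<in> S" for s'
    using that xZ BE by (intro subset_cl) blast
  have "p x \<in> cl {s, x}" using p_iff[OF xZ, of "{s, x}"] supp sS xZ by blast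
  then have "cl {s, x} = {s, x, p x}" using cl_line[OF sS] sub_line[OF sS] by blast
  then have "line s x (p x)"
    using sS x p(1,2)[OF xZ] S_subset_E unfolding line_def by blast
  moreover have "cl {s', x} = {s', x}" if s': "s' \<in> S" "s' \<noteq> s" for s'
  proof -
    have "s \<notin> {s', x}" using s' sS x by blast
    then have "p x \<notin> cl {s', x}" using p_iff[OF xZ, of "{s', x}"] supp(2) s'(1) xZ by blast
    then show ?thesis using cl_line[OF s'(1)] sub_line[OF s'(1)] by blast
  qed
  ultimately show ?thesis using that sS by blast
qed

end

section \<open>Collinearity classes and the isomorphism\<close>

definition collinear :: "'a \<Rightarrow> 'a \<Rightarrow> bool" where
  "collinear x y \<longleftrightarrow> x = y \<or> cl {x, y} \<noteq> {x, y}"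

lemma collinear_sym: "collinear x y \<Longrightarrow> collinear y x"
  unfolding collinear_def by (metis insert_commute)

lemma not_collinear_claw:
  assumes "claw E indep S" "x \<in> S" "y \<in> S" "x \<noteq> y" shows "\<not> collinear x y"
proof -
  have "indep S" "cl S = S" using assms(1) unfolding claw_def flat_def by auto
  moreover have "cl {x, y} \<subseteq> cl S" using assms by (intro cl_mono) blast
  ultimately have "cl {x, y} = {x, y}" using cl_Int_indep[of S "{x, y}"] assms by blast
  then show ?thesis using assms(4) unfolding collinear_def by blast
qed

text \<open>If \<open>x\<close> and \<open>z\<close> were not collinear, \<open>{x, z}\<close> would
  be a claw and extend to a \<open>t\<close>-claw \<open>S\<close>. Then \<open>y\<close> would be
  collinear with two members of \<open>S\<close>, against \<open>unique_line_to_S\<close>.\<close>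

lemma collinear_trans:
  assumes "x \<in> E" "y \<in> E" "z \<in> E" "collinear x y" "collinear y z"
  shows "collinear x z"
proof (rule ccontr)
  assume n: "\<not> collinear x z"
  then have xz: "x \<noteq> z" "cl {x, z} = {x, z}" unfolding collinear_def by auto
  then have "claw E indep {x, z}" using claw_iff indep_pair assms by blast
  then obtain S where S: "{x, z} \<subseteq> S" "claw E indep S" "card S = t" by (rule claw_extends)
  have ne: "x \<noteq> y" "y \<noteq> z" using n assms by auto
  have "y \<notin> S" using not_collinear_claw[OF S(2)] S(1) ne assms(4) by blast
  then have y: "y \<in> E - S" using assms by blast
  obtain s where s: "s \<in> S" "\<And>s'. s' \<in> S \<Longrightarrow> s' \<noteq> s \<Longrightarrow> cl {s', y} = {s', y}"
    using unique_line_to_S[OF S(2,3) y] by blast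
  have "\<not> collinear s' y" if "s' \<in> S" "s' \<noteq> s" for s'
    using s(2)[OF that] that \<open>y \<notin> S\<close> unfolding collinear_def by blast
  then have "x = s" "z = s" using S(1) assms collinear_sym by blast+
  then show False using xz by blast
qed

lemma claw_singleton: "x \<in> E \<Longrightarrow> claw E indep {x}"
  using indep_pair[of x x] by (simp add: claw_iff cl_singleton)

text \<open>Extend \<open>{x}\<close> to a \<open>t\<close>-claw. Its only member collinear with
  \<open>y\<close> is the one on a three-point line with \<open>y\<close>, so that member is
  \<open>x\<close>.\<close>

lemma collinear_line:
  assumes "x \<in> E" "y \<in> E" "x \<noteq> y" "collinear x y"
  obtains z where "line x y z"
proof -
  obtain S where S: "{x} \<subseteq> S" "claw E indep S" "card S = t"
    using claw_extends[OF claw_singleton[OF assms(1)]] by blast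
  have "y \<notin> S" using not_collinear_claw[OF S(2)] S(1) assms by blast
  then have y: "y \<in> E - S" using assms by blast
  obtain s y' where s: "s \<in> S" "line s y y'" "\<And>s'. s' \<in> S \<Longrightarrow> s' \<noteq> s \<Longrightarrow> cl {s', y} = {s', y}"
    using unique_line_to_S[OF S(2,3) y] by blast
  have "x = s" using s(3)[of x] S(1) assms unfolding collinear_def by blast
  then show ?thesis using that s(2) by blast
qed

lemma line_collinear: "line x y z \<Longrightarrow> collinear x y"
  unfolding line_def collinear_def by blast

lemma projective_class:
  assumes "s \<in> E" shows "projective {x \<in> E. collinear s x}"
  unfolding projective_def
proof (intro conjI ballI impI)
  fix x y assume x: "x \<in> {x \<in> E. collinear s x}" and y: "y \<in> {x \<in> E. collinear s x}" and ne: "x \<noteq> y"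
  have xy: "x \<in> E" "y \<in> E" "collinear x s" "collinear s x" "collinear s y"
    using x y collinear_sym by auto
  have "collinear x y" using collinear_trans[of x s y] xy assms by blast
  then obtain z where z: "line x y z" using collinear_line xy(1,2) ne by blast
  have "collinear x z" using line_collinear line_rot[OF z] by blast
  moreover have "z \<in> E" using line_rot[OF z] unfolding line_def by blast
  ultimately have "collinear s z" using collinear_trans[of s x z] xy assms by blast
  then show "\<exists>z\<in>{x \<in> E. collinear s x}. line x y z" using z \<open>z \<in> E\<close> by blast
qed blast

text \<open>The classes of the members of a \<open>t\<close>-claw partition \<open>E\<close>. An
  element is sent to the index of the component matched with its class, paired with its coordinates
  in that class.\<close>

theorem iso_Mrt: "matroid_iso E indep (Mrt_ground (rk E) t) (Mrt_indep (rk E) t)"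
proof -
  let ?r = "rk E"
  have "claw E indep {}" using claw_iff indep_empty cl_empty by simp
  then obtain S where S: "claw E indep S" "card S = t" using claw_extends by blast
  have SE: "S \<subseteq> E" using S(1) unfolding claw_def flat_def by blast
  have finS: "finite S" using SE finite_E finite_subset by blast
  define C where "C s = {x \<in> E. collinear s x}" for s
  have proj: "projective (C s)" if "s \<in> S" for s
    using projective_class that SE unfolding C_def by blast
  have "x \<in> (\<Union>s\<in>S. C s)" if x: "x \<in> E" for x
  proof (cases "x \<in> S")
    case True
    then show ?thesis using x unfolding C_def collinear_def by blast
  next
    case False
    then have xS: "x \<in> E - S" using x by blast
    obtain s x' where s: "s \<in> S" "line s x x'" by (rule unique_line_to_S[OF S xS])
    have "x \<in> C s" using x line_collinear[OF s(2)] unfolding C_def by blast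
    then show ?thesis using s(1) by blast
  qed
  then have E: "E = (\<Union>s\<in>S. C s)" unfolding C_def by blast
  have disj: "C s \<inter> C u = {}" if su: "s \<in> S" "u \<in> S" "s \<noteq> u" for s u
  proof (rule ccontr)
    assume "C s \<inter> C u \<noteq> {}"
    then obtain x where x: "x \<in> E" "collinear s x" "collinear x u"
      using collinear_sym unfolding C_def by blast
    have "collinear s u" by (rule collinear_trans[of s x u]) (use x su SE in auto)
    then show False using not_collinear_claw[OF S(1) su] by blast
  qed
  have finC: "finite (C s)" for s unfolding C_def using finite_E by simp
  have size: "2 ^ rk (C s) - 1 \<le> card (C s)" if s: "s \<in> S" for s
  proof -
    obtain B where B: "basis_of (C s) B" by (rule basis_exists)
    then have "2 ^ card B - 1 \<le> card (cl B \<inter> C s)"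
      using projective_card_ge[OF proj[OF s]] unfolding basis_of_def by blast
    also have "\<dots> \<le> card (C s)" by (rule card_mono[OF finC]) blast
    finally show ?thesis using basis_of_card[OF B] by simp
  qed
  have total: "(\<Sum>s\<in>S. card (C s)) = card (Mrt_ground ?r t)"
  proof -
    have "(\<Sum>s\<in>S. card (C s)) = card (\<Union>s\<in>S. C s)"
      by (rule card_UN_disjoint[symmetric]) (use finS finC disj in auto)
    also have "\<dots> = card E" using E by simp
    finally show ?thesis using card_E card_Mrt_ground_eq_extremal_size[OF t_pos] by simp
  qed
  \<comment> \<open>Minimality of the total size gives three facts at once: the class ranks add up
    to the rank of \<open>E\<close>, every class has the least possible size, and the ranks are
    balanced.\<close>
  have balanced: "(\<Sum>s\<in>S. rk (C s)) = ?r" "\<And>s. s \<in> S \<Longrightarrow> card (C s) = 2 ^ rk (C s) - 1"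
    "\<And>s. s \<in> S \<Longrightarrow> rk (C s) = ?r div t \<or> rk (C s) = Suc (?r div t)"
    by (rule balanced_if_minimal[OF finS S(2) t_pos rk_le_sum[OF E finS] size total]; assumption)+
  obtain g where g: "bij_betw g S {..<t}" "\<And>s. s \<in> S \<Longrightarrow> comp_rank ?r t (g s) = rk (C s)"
    by (rule comp_rank_enumeration[OF finS S(2) t_pos balanced(1,3)]; blast)
  have "\<forall>s\<in>S. \<exists>\<phi>. bij_betw \<phi> (C s) (PG_ground (rk (C s))) \<and>
      (\<forall>X. X \<subseteq> C s \<longrightarrow> (indep X \<longleftrightarrow> gf2_indep (\<phi> ` X)))"
  proof
    fix s assume s: "s \<in> S"
    show "\<exists>\<phi>. bij_betw \<phi> (C s) (PG_ground (rk (C s))) \<and>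
      (\<forall>X. X \<subseteq> C s \<longrightarrow> (indep X \<longleftrightarrow> gf2_indep (\<phi> ` X)))"
      by (rule projective_iso_PG[OF proj[OF s] balanced(2)[OF s]]) blast
  qed
  then obtain \<phi> where \<phi>: "\<And>s. s \<in> S \<Longrightarrow> bij_betw (\<phi> s) (C s) (PG_ground (rk (C s)))"
    "\<And>s X. s \<in> S \<Longrightarrow> X \<subseteq> C s \<Longrightarrow> indep X \<longleftrightarrow> gf2_indep (\<phi> s ` X)"
    by metis
  have "\<forall>x\<in>E. \<exists>s. s \<in> S \<and> x \<in> C s" using E by blast
  then obtain c where c: "\<And>x. x \<in> E \<Longrightarrow> c x \<in> S" "\<And>x. x \<in> E \<Longrightarrow> x \<in> C (c x)" by metis
  have c_eq: "c x = s" if "x \<in> C s" "s \<in> S" for x s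
  proof -
    have "x \<in> E" using that(1) unfolding C_def by blast
    then show ?thesis using c[of x] disj[of "c x" s] that by blast
  qed
  define f where "f x = (g (c x), \<phi> (c x) x)" for x
  have f_class: "f x = (g s, \<phi> s x)" if "x \<in> C s" "s \<in> S" for x s
    unfolding f_def using c_eq[OF that] by simp
  have g_inj: "s = u" if "g s = g u" "s \<in> S" "u \<in> S" for s u
    using g(1) that unfolding bij_betw_def inj_on_def by blast
  have g_lt: "g s < t" if "s \<in> S" for s using g(1) that unfolding bij_betw_def by blast
  have g_surj: "\<exists>s\<in>S. i = g s" if "i < t" for i using g(1) that unfolding bij_betw_def by blast
  have "inj_on f E"
  proof (rule inj_onI)
    fix x y assume xy: "x \<in> E" "y \<in> E" "f x = f y"
    then have cc: "c x = c y" using g_inj c(1) unfolding f_def by blast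
    then have "\<phi> (c x) x = \<phi> (c x) y" using xy(3) unfolding f_def by simp
    moreover have "inj_on (\<phi> (c x)) (C (c x))" using \<phi>(1)[OF c(1)[OF xy(1)]] unfolding bij_betw_def by blast
    ultimately show "x = y" using c(2)[OF xy(1)] c(2)[OF xy(2)] cc by (metis inj_onD)
  qed
  moreover have "f ` E = Mrt_ground ?r t"
  proof
    show "f ` E \<subseteq> Mrt_ground ?r t"
    proof
      fix v assume "v \<in> f ` E"
      then obtain x where x: "x \<in> E" "v = f x" by blast
      have "\<phi> (c x) x \<in> PG_ground (rk (C (c x)))"
        using \<phi>(1)[OF c(1)[OF x(1)]] c(2)[OF x(1)] unfolding bij_betw_def by blast
      then show "v \<in> Mrt_ground ?r t"
        using x g_lt[OF c(1)[OF x(1)]] g(2)[OF c(1)[OF x(1)]] unfolding Mrt_ground_def f_def by simp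
    qed
    show "Mrt_ground ?r t \<subseteq> f ` E"
    proof
      fix iv assume "iv \<in> Mrt_ground ?r t"
      then obtain i v where iv: "iv = (i, v)" "i < t" "v \<in> PG_ground (comp_rank ?r t i)"
        unfolding Mrt_ground_def by blast
      obtain s where s: "s \<in> S" "i = g s" using g_surj[OF iv(2)] by blast
      then have "v \<in> \<phi> s ` C s" using \<phi>(1)[OF s(1)] g(2)[OF s(1)] iv(3) unfolding bij_betw_def by simp
      then obtain x where x: "x \<in> C s" "v = \<phi> s x" by blast
      then have "f x = iv" using f_class[OF x(1) s(1)] iv(1) s(2) by simp
      moreover have "x \<in> E" using x(1) unfolding C_def by blast
      ultimately show "iv \<in> f ` E" by blast
    qed
  qed
  ultimately have bij: "bij_betw f E (Mrt_ground ?r t)" unfolding bij_betw_def by blast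
  have "indep X \<longleftrightarrow> Mrt_indep ?r t (f ` X)" if X: "X \<subseteq> E" for X
  proof -
    \<comment> \<open>The part of the image in component \<open>g s\<close> comes only from the
      class of \<open>s\<close>, so the componentwise condition becomes one on the traces
      \<open>X \<inter> C s\<close>.\<close>
    have fibre: "{v. (g s, v) \<in> f ` X} = \<phi> s ` (X \<inter> C s)" if s: "s \<in> S" for s
    proof
      show "{v. (g s, v) \<in> f ` X} \<subseteq> \<phi> s ` (X \<inter> C s)"
      proof
        fix v assume "v \<in> {v. (g s, v) \<in> f ` X}"
        then obtain x where x: "x \<in> X" "(g s, v) = f x" by blast
        have xE: "x \<in> E" using x X by blast
        have "c x = s" using x(2) g_inj[OF _ c(1)[OF xE] s] unfolding f_def by simp
        then show "v \<in> \<phi> s ` (X \<inter> C s)" using x c(2)[OF xE] unfolding f_def by blast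
      qed
      show "\<phi> s ` (X \<inter> C s) \<subseteq> {v. (g s, v) \<in> f ` X}" using f_class s by force
    qed
    have "Mrt_indep ?r t (f ` X) \<longleftrightarrow> (\<forall>i<t. gf2_indep {v. (i, v) \<in> f ` X})"
      using bij X unfolding Mrt_indep_def bij_betw_def by blast
    also have "\<dots> \<longleftrightarrow> (\<forall>s\<in>S. gf2_indep {v. (g s, v) \<in> f ` X})"
      using g_lt g_surj by metis
    also have "\<dots> \<longleftrightarrow> (\<forall>s\<in>S. indep (X \<inter> C s))"
      using fibre \<phi>(2) by (metis inf_le2)
    also have "\<dots> \<longleftrightarrow> indep X" using indep_direct_sum[OF E finS balanced(1) X] by blast
    finally show ?thesis by blast
  qed
  then show ?thesis using bij unfolding matroid_iso_def by blast
qed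

end

theorem theorem1p1:
  fixes E :: "'a set" and indep :: "'a set \<Rightarrow> bool" and r t :: nat
  assumes "1 \<le> r" and "1 \<le> t"
    and "matroid E indep"
    and "simple_matroid E indep"
    and "mrank E indep E = r"
    and "\<not> (\<exists>S. claw E indep S \<and> card S = t + 1)"
  shows "card (Mrt_ground r t) \<le> card E \<and>
         (card E = card (Mrt_ground r t) \<and> 2 * t \<le> r \<longrightarrow>
            matroid_iso E indep (Mrt_ground r t) (Mrt_indep r t))"
proof -
  interpret simple_indep_matroid E indep
    using assms(3,4) by unfold_locales
  have t: "0 < t" using assms(2) by simp
  have size: "card (Mrt_ground r t) = extremal_size r t"
    using card_Mrt_ground_eq_extremal_size[OF t] .
  have "matroid_iso E indep (Mrt_ground r t) (Mrt_indep r t)"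
    if "card E = card (Mrt_ground r t)" "2 * t \<le> r"
  proof -
    interpret extremal_matroid E indep t
      using t assms(5,6) that size by unfold_locales auto
    show ?thesis using iso_Mrt assms(5) by simp
  qed
  then show ?thesis using card_ge_extremal_size[OF t assms(6)] size assms(5) by simp
qed

end
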